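(* Let $G$ be a matching covered graph and let $K$ be any 3-claw of $G$. Then $K$ is a subgraph of some conformal subgraph $H$ of $G$ such that $H$ is either a bi-subdivision of $\Theta$ or a bi-subdivision of $K_4$.
   Context: Graphs are finite and loopless; multiple edges are allowed. A graph is matchable if it has a perfect matching (the empty graph is matchable). A connected graph with at least two vertices is matching covered if each edge lies in some perfect matching. $\Theta$ is the graph with two vertices joined by three edges. A 3-claw of a graph $G$ is a subgraph formed by three distinct edges that are all incident with a common vertex (two or all three of these edges may be parallel). A subgraph $H$ of $G$ is conformal if $G-V(H)$ is matchable. A bi-subdivision of a graph $J$ is a graph obtained from $J$ by subdividing each edge of some subset of $E(J)$ with an even number of subdivision vertices. *)

theory Defs
  imports Main
begin

text \<open>
  Graphs are undirected and may have multiple edges, so edges are objects of their own and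
  \<open>ends G e\<close> is the set of end vertices of \<open>e\<close>.  Only the values of \<open>ends G\<close> on \<open>edges G\<close>
  are meaningful.
\<close>

record ('v, 'e) mgraph =
  verts :: "'v set"
  edges :: "'e set"
  ends :: "'e \<Rightarrow> 'v set"

definition graph :: "('v, 'e) mgraph \<Rightarrow> bool" where
  "graph G \<longleftrightarrow> finite (verts G) \<and> finite (edges G) \<and>
     (\<forall>e \<in> edges G. ends G e \<subseteq> verts G \<and> card (ends G e) = 2)"

definition subgraph :: "('v, 'e) mgraph \<Rightarrow> ('v, 'e) mgraph \<Rightarrow> bool" where
  "subgraph H G \<longleftrightarrow> graph H \<and> graph G \<and> verts H \<subseteq> verts G \<and> edges H \<subseteq> edges G \<and>
     (\<forall>e \<in> edges H. ends H e = ends G e)"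

definition delete_verts :: "('v, 'e) mgraph \<Rightarrow> 'v set \<Rightarrow> ('v, 'e) mgraph" where
  "delete_verts G S =
     \<lparr> verts = verts G - S, edges = {e \<in> edges G. ends G e \<inter> S = {}}, ends = ends G \<rparr>"

definition matching :: "('v, 'e) mgraph \<Rightarrow> 'e set \<Rightarrow> bool" where
  "matching G M \<longleftrightarrow> M \<subseteq> edges G \<and>
     (\<forall>e \<in> M. \<forall>f \<in> M. e \<noteq> f \<longrightarrow> ends G e \<inter> ends G f = {})"

definition perfect_matching :: "('v, 'e) mgraph \<Rightarrow> 'e set \<Rightarrow> bool" where
  "perfect_matching G M \<longleftrightarrow> matching G M \<and> (\<forall>v \<in> verts G. \<exists>e \<in> M. v \<in> ends G e)"

definition matchable :: "('v, 'e) mgraph \<Rightarrow> bool" where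
  "matchable G \<longleftrightarrow> (\<exists>M. perfect_matching G M)"

text \<open>
  A path is given by its vertices and its edges in order of traversal; a single vertex
  (with no edges) is a path.
\<close>

definition is_path :: "('v, 'e) mgraph \<Rightarrow> 'v list \<Rightarrow> 'e list \<Rightarrow> bool" where
  "is_path G vs es \<longleftrightarrow> length vs = Suc (length es) \<and> distinct vs \<and>
     set vs \<subseteq> verts G \<and> set es \<subseteq> edges G \<and>
     (\<forall>i < length es. ends G (es ! i) = {vs ! i, vs ! Suc i})"

definition inner_verts :: "'v list \<Rightarrow> 'v list" where
  "inner_verts vs = butlast (tl vs)"

definition connected_graph :: "('v, 'e) mgraph \<Rightarrow> bool" where
  "connected_graph G \<longleftrightarrow> verts G \<noteq> {} \<and>
     (\<forall>u \<in> verts G. \<forall>v \<in> verts G. \<exists>vs es. is_path G vs es \<and> hd vs = u \<and> last vs = v)"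

definition matching_covered :: "('v, 'e) mgraph \<Rightarrow> bool" where
  "matching_covered G \<longleftrightarrow> graph G \<and> connected_graph G \<and> card (verts G) \<ge> 2 \<and>
     (\<forall>e \<in> edges G. \<exists>M. perfect_matching G M \<and> e \<in> M)"

definition conformal :: "('v, 'e) mgraph \<Rightarrow> ('v, 'e) mgraph \<Rightarrow> bool" where
  "conformal G H \<longleftrightarrow> subgraph H G \<and> matchable (delete_verts G (verts H))"

definition three_claw :: "('v, 'e) mgraph \<Rightarrow> ('v, 'e) mgraph \<Rightarrow> bool" where
  "three_claw G K \<longleftrightarrow> subgraph K G \<and> card (edges K) = 3 \<and>
     verts K = (\<Union>e \<in> edges K. ends K e) \<and> (\<exists>v. \<forall>e \<in> edges K. v \<in> ends K e)"

text \<open>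
  \<open>H\<close> arises (up to isomorphism) from \<open>J\<close> by replacing every edge \<open>e\<close> by a path with vertices
  \<open>Pv e\<close> and edges \<open>Pe e\<close> between the images of the ends of \<open>e\<close>, whose inner vertices are the
  subdivision vertices of \<open>e\<close>.  An edge that is not subdivided has a path of length one.
  Disjointness of the edge sets is not implied by the other conditions: without it, parallel
  edges of \<open>J\<close> could share a path of length one.
\<close>

definition bi_subdivision :: "('a, 'b) mgraph \<Rightarrow> ('v, 'e) mgraph \<Rightarrow> bool" where
  "bi_subdivision J H \<longleftrightarrow> graph J \<and> graph H \<and>
     (\<exists>\<phi> Pv Pe.
        inj_on \<phi> (verts J) \<and>
        (\<forall>e \<in> edges J.
           is_path H (Pv e) (Pe e) \<and>
           {hd (Pv e), last (Pv e)} = \<phi> ` ends J e \<and>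
           even (length (inner_verts (Pv e))) \<and>
           set (inner_verts (Pv e)) \<inter> \<phi> ` verts J = {}) \<and>
        (\<forall>e \<in> edges J. \<forall>f \<in> edges J. e \<noteq> f \<longrightarrow>
           set (inner_verts (Pv e)) \<inter> set (inner_verts (Pv f)) = {} \<and>
           set (Pe e) \<inter> set (Pe f) = {}) \<and>
        verts H = \<phi> ` verts J \<union> (\<Union>e \<in> edges J. set (inner_verts (Pv e))) \<and>
        edges H = (\<Union>e \<in> edges J. set (Pe e)))"

definition Theta :: "(nat, nat) mgraph" where
  "Theta = \<lparr> verts = {0, 1}, edges = {0, 1, 2}, ends = (\<lambda>_. {0, 1}) \<rparr>"

definition K4 :: "(nat, nat set) mgraph" where
  "K4 = \<lparr> verts = {0..<4}, edges = {e. e \<subseteq> {0..<4} \<and> card e = 2}, ends = (\<lambda>e. e) \<rparr>"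

end

theory Submission imports Defs begin

text \<open>
  Let \<open>v\<close> be the center of the claw and \<open>u1\<close>, \<open>u2\<close>, \<open>u3\<close> the other ends of its edges.  Since every
  edge lies in a perfect matching, each \<open>G - v - ui\<close> is matchable.  It suffices to find in \<open>G - v\<close>
  a conformal configuration: three disjoint legs of even length ending at \<open>u1\<close>, \<open>u2\<close>, \<open>u3\<close> that
  start either at a common vertex (adding \<open>v\<close> gives a bi-subdivision of \<open>\<Theta>\<close>) or at three vertices
  that split an odd cycle into three arcs of odd length (adding \<open>v\<close> gives a bi-subdivision of
  \<open>K\<^sub>4\<close>).

  Fix a perfect matching of \<open>G - v - u1\<close>.  There are alternating paths \<open>P\<close> and \<open>Q\<close> of even length
  from \<open>u1\<close> to \<open>u2\<close> and to \<open>u3\<close>.  If they begin with the same edge, the first two vertices can be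
  removed and restored later as an extension of the leg of \<open>u1\<close>.  If they meet only in \<open>u1\<close>, their
  union is a configuration.  Otherwise consider the first vertex \<open>y\<close> of \<open>Q - u1\<close> on \<open>P\<close>.  If \<open>y\<close> is
  at odd distance from \<open>u1\<close> on \<open>P\<close>, the initial part of \<open>P\<close> can be rerouted along \<open>Q\<close>.  If the
  distance is even, the initial parts of \<open>P\<close> and \<open>Q\<close> form an odd cycle, as in Edmonds' blossom
  algorithm; it is contracted, and a configuration of the contracted graph is lifted using the
  fact that any three vertices of an odd cycle either split it into three odd arcs or are joined
  to one of its vertices by disjoint paths of even length, with a matchable remainder.
\<close>

section \<open>Perfect matchings of vertex sets\<close>

text \<open>Matchings refer to an adjacency relation and a vertex set, without edge objects:
  contracting a cycle then only changes the relation. Edges come back in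
  \<open>matched_edges\<close>.\<close>

inductive matched :: "('v \<Rightarrow> 'v \<Rightarrow> bool) \<Rightarrow> 'v set \<Rightarrow> bool" for E where
  empty: "matched E {}"
| pair: "matched E X \<Longrightarrow> x \<notin> X \<Longrightarrow> y \<notin> X \<Longrightarrow> x \<noteq> y \<Longrightarrow> E x y \<Longrightarrow> matched E (insert x (insert y X))"

lemma matched_Un:
  assumes "matched E X" "matched E Y" "X \<inter> Y = {}"
  shows "matched E (X \<union> Y)"
  using assms
proof (induction rule: matched.induct)
  case (pair X x y)
  then have "matched E (insert x (insert y (X \<union> Y)))"
    by (intro matched.pair) auto
  then show ?case by simp
qed simp

lemma matched_mono:
  assumes "matched E X" "\<And>x y. x \<in> X \<Longrightarrow> y \<in> X \<Longrightarrow> E x y \<Longrightarrow> E' x y"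
  shows "matched E' X"
  using assms by (induction rule: matched.induct) (auto intro!: matched.intros)

lemma matched_path:
  assumes "successively E L" "distinct L" "even (length L)"
  shows "matched E (set L)"
  using assms
proof (induction L rule: induct_list012)
  case (3 x y L)
  then show ?case by (auto intro!: matched.pair simp: successively_Cons)
qed (auto intro: matched.empty)

text \<open>The same matchings as fixed-point-free involutions. \<open>matched\<close> is convenient
  for disjoint unions; the mate function is what alternating paths need, and it restricts to every
  subset that is closed under it.\<close>

definition mate_on :: "('v \<Rightarrow> 'v \<Rightarrow> bool) \<Rightarrow> ('v \<Rightarrow> 'v) \<Rightarrow> 'v set \<Rightarrow> bool" where
  "mate_on E m W \<longleftrightarrow> (\<forall>x\<in>W. m x \<in> W \<and> m x \<noteq> x \<and> m (m x) = x \<and> E x (m x))"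

lemma mate_on_Diff:
  assumes "mate_on E m W" "\<And>x. x \<in> W \<Longrightarrow> x \<in> Y \<longleftrightarrow> m x \<in> Y"
  shows "mate_on E m (W - Y)"
  using assms unfolding mate_on_def by blast

lemma mate_on_matched:
  assumes "finite W" "mate_on E m W"
  shows "matched E W"
  using assms
proof (induction "card W" arbitrary: W rule: less_induct)
  case less
  show ?case
  proof (cases "W = {}")
    case True
    then show ?thesis by (simp add: matched.empty)
  next
    case False
    then obtain x where x: "x \<in> W" by blast
    let ?W = "W - {x, m x}"
    have mx: "m x \<in> W" "m x \<noteq> x" "E x (m x)" using x less.prems by (auto simp: mate_on_def)
    have "mate_on E m ?W"
    proof (rule mate_on_Diff[OF less.prems(2)])
      show "z \<in> {x, m x} \<longleftrightarrow> m z \<in> {x, m x}" if "z \<in> W" for z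
        using less.prems(2) x that unfolding mate_on_def by (metis insert_iff singletonD)
    qed
    moreover have "card ?W < card W" using x less.prems by (intro psubset_card_mono) auto
    ultimately have "matched E ?W" using less by auto
    then have "matched E (insert x (insert (m x) ?W))"
      using mx by (intro matched.pair) auto
    moreover have "insert x (insert (m x) ?W) = W" using x mx by auto
    ultimately show ?thesis by simp
  qed
qed

section \<open>Odd cycles\<close>

lemma successively_rev_symp: "symp E \<Longrightarrow> successively E (rev zs) \<longleftrightarrow> successively E zs"
proof -
  assume "symp E"
  then have "(\<lambda>x y. E y x) = E" by (blast dest: sympD)
  then show ?thesis unfolding successively_rev by metis
qed

definition cycle :: "('v \<Rightarrow> 'v \<Rightarrow> bool) \<Rightarrow> 'v list \<Rightarrow> bool" where
  "cycle E L \<longleftrightarrow> L \<noteq> [] \<and> distinct L \<and> successively E L \<and> E (last L) (hd L)"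

lemma cycle_rotate: "cycle E (xs @ ys) \<Longrightarrow> cycle E (ys @ xs)"
  by (cases "xs = []"; cases "ys = []") (auto simp: cycle_def successively_append_iff)

lemma cycle_rev: "symp E \<Longrightarrow> cycle E L \<Longrightarrow> cycle E (rev L)"
  by (auto simp: cycle_def hd_rev last_rev symp_def elim!: successively_mono)

lemma cycle_start:
  assumes "cycle E L" "x \<in> set L"
  obtains R where "cycle E (x # R)" "set (x # R) = set L" "length (x # R) = length L"
proof -
  obtain ys zs where L: "L = ys @ x # zs" using split_list assms(2) by metis
  have "cycle E ((x # zs) @ ys)" using assms(1) unfolding L by (rule cycle_rotate)
  then show ?thesis using that[of "zs @ ys"] L by auto
qed

text \<open>Legs are listed without their common start \<open>p\<close>. Hence an empty leg ends at
  \<open>p\<close>, and distinctness of the concatenation says that the legs meet only in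
  \<open>p\<close>.\<close>

definition spider ::
  "('v \<Rightarrow> 'v \<Rightarrow> bool) \<Rightarrow> 'v \<Rightarrow> 'v list \<Rightarrow> 'v list \<Rightarrow> 'v list \<Rightarrow> 'v \<Rightarrow> 'v \<Rightarrow> 'v \<Rightarrow> bool" where
  "spider E p L1 L2 L3 u1 u2 u3 \<longleftrightarrow>
     successively E (p # L1) \<and> successively E (p # L2) \<and> successively E (p # L3) \<and>
     distinct (p # L1 @ L2 @ L3) \<and> even (length L1) \<and> even (length L2) \<and> even (length L3) \<and>
     last (p # L1) = u1 \<and> last (p # L2) = u2 \<and> last (p # L3) = u3"

text \<open>\<open>A\<close>, \<open>A'\<close>, \<open>A''\<close> are the interiors of the arcs,
  so even lists mean arcs of odd length: this is a bi-subdivision of a triangle, that is, of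
  \<open>K4\<close> minus a vertex.\<close>

definition odd_triangle ::
  "('v \<Rightarrow> 'v \<Rightarrow> bool) \<Rightarrow> 'v \<Rightarrow> 'v list \<Rightarrow> 'v \<Rightarrow> 'v list \<Rightarrow> 'v \<Rightarrow> 'v list \<Rightarrow> bool" where
  "odd_triangle E b1 A b2 A' b3 A'' \<longleftrightarrow>
     cycle E (b1 # A @ b2 # A' @ b3 # A'') \<and>
     even (length A) \<and> even (length A') \<and> even (length A'')"

text \<open>On an odd cycle the two arcs between distinct vertices have lengths of different parity.
  The even one is taken; the interior of the odd one has evenly many vertices and is matched along
  itself.\<close>

lemma even_arc:
  assumes E: "symp E" and c: "cycle E L" "odd (length L)" and xy: "x \<in> set L" "y \<in> set L"
  obtains S where "successively E (x # S)" "distinct (x # S)" "even (length S)" "last (x # S) = y"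
    "set (x # S) \<subseteq> set L" "matched E (set L - set (x # S))"
proof -
  obtain R where R: "cycle E (x # R)" "set (x # R) = set L" "length (x # R) = length L"
    using cycle_start[OF c(1) xy(1)] .
  note symE = sympD[OF E]
  show ?thesis
  proof (cases "y = x")
    case True
    have "matched E (set R)"
      by (rule matched_path) (use R c in \<open>auto simp: cycle_def successively_Cons simp flip: R(3)\<close>)
    moreover have "set L - set [x] = set R" using R by (auto simp: cycle_def)
    ultimately show ?thesis using that[of "[]"] True xy by simp
  next
    case False
    then obtain R1 R2 where RR: "R = R1 @ y # R2"
      using xy R(2) by (metis set_ConsD split_list)
    have "length R1 + length R2 + 2 = length L" using R(3) RR by simp
    then have len: "odd (length R1) \<longleftrightarrow> even (length R2)" using c(2) by presburger
    show ?thesis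
    proof (cases "odd (length R1)")
      case True
      have "matched E (set R2)"
        by (rule matched_path)
          (use R(1) len True in \<open>auto simp: RR cycle_def successively_append_iff successively_Cons\<close>)
      moreover have "set L - set (x # R1 @ [y]) = set R2" using R RR by (auto simp: cycle_def)
      ultimately show ?thesis using R True
        by (intro that[of "R1 @ [y]"])
          (auto simp: cycle_def hd_append RR successively_append_iff successively_Cons simp flip: R(2))
    next
      case False
      have "matched E (set R1)"
        by (rule matched_path)
          (use R(1) len False in \<open>auto simp: RR cycle_def successively_append_iff successively_Cons\<close>)
      moreover have "set L - set (x # rev R2 @ [y]) = set R1" using R RR by (auto simp: cycle_def)
      moreover have "successively E (rev (y # R2 @ [x]))"
        unfolding successively_rev
        by (rule successively_mono[where P = E])
          (use R(1) symE in \<open>auto simp: RR cycle_def hd_append successively_append_iff successively_Cons\<close>)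
      ultimately show ?thesis using R False len
        by (intro that[of "rev R2 @ [y]"])
          (auto simp: cycle_def RR simp flip: R(2))
    qed
  qed
qed

text \<open>The three interiors have even total size, so either all are even, which gives the
  triangle, or exactly two are odd. Those two arcs have even length and share an end, which becomes
  the center \<open>p\<close>; the even interior of the third arc is matched along itself.\<close>

lemma three_points_ordered:
  assumes E: "symp E" and c: "cycle E L" "odd (length L)" and L: "L = r # A @ x # A' @ y # A''"
  shows "odd_triangle E r A x A' y A'' \<or>
    (\<exists>p L1 L2 L3. spider E p L1 L2 L3 r x y \<and> set (p # L1 @ L2 @ L3) \<subseteq> set L \<and>
       matched E (set L - set (p # L1 @ L2 @ L3)))"
proof -
  note rev = successively_rev_symp[OF E]
  have "length L = length A + length A' + length A'' + 3" by (simp add: L)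
  then have par: "even (length A + length A' + length A'')" using c(2) by presburger
  have succ: "successively E A" "successively E A'" "successively E A''"
    using c(1) by (auto simp: L cycle_def successively_append_iff successively_Cons)
  have paths: "successively E (r # A @ [x])" "successively E (x # A' @ [y])"
    "successively E (y # A'' @ [r])"
    using c(1) by (auto simp: L cycle_def successively_append_iff successively_Cons hd_append)
  then have rpaths: "successively E (x # rev A @ [r])" "successively E (y # rev A' @ [x])"
    "successively E (r # rev A'' @ [y])"
    using rev[of "r # A @ [x]"] rev[of "x # A' @ [y]"] rev[of "y # A'' @ [r]"] by (auto simp del: successively_rev)
  have d: "distinct L" using c(1) by (simp add: cycle_def)
  have close: ?thesis if "spider E p L1 L2 L3 r x y" "set (p # L1 @ L2 @ L3) \<subseteq> set L"
    "set L - set (p # L1 @ L2 @ L3) = S" "matched E S" for p L1 L2 L3 S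
    using that by metis
  consider "even (length A)" "even (length A')" "even (length A'')"
    | "odd (length A)" "odd (length A')" "even (length A'')"
    | "odd (length A)" "even (length A')" "odd (length A'')"
    | "even (length A)" "odd (length A')" "odd (length A'')"
    using par by (metis even_add)
  then show ?thesis
  proof cases
    case 1
    then show ?thesis using c(1) by (simp add: odd_triangle_def L)
  next
    case 2
    have eq: "set L - set (x # (rev A @ [r]) @ [] @ (A' @ [y])) = set A''"
      using d by (auto simp: L)
    have m: "matched E (set A'')" using 2 d succ by (intro matched_path) (auto simp: L)
    have sp: "spider E x (rev A @ [r]) [] (A' @ [y]) r x y"
      using 2 d paths rpaths by (auto simp: spider_def L)
    show ?thesis by (rule close[OF sp _ eq m]) (auto simp: L)
  next
    case 3
    have eq: "set L - set (r # [] @ (A @ [x]) @ (rev A'' @ [y])) = set A'"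
      using d by (auto simp: L)
    have m: "matched E (set A')" using 3 d succ by (intro matched_path) (auto simp: L)
    have sp: "spider E r [] (A @ [x]) (rev A'' @ [y]) r x y"
      using 3 d paths rpaths by (auto simp: spider_def L)
    show ?thesis by (rule close[OF sp _ eq m]) (auto simp: L)
  next
    case 4
    have eq: "set L - set (y # (A'' @ [r]) @ (rev A' @ [x]) @ []) = set A"
      using d by (auto simp: L)
    have m: "matched E (set A)" using 4 d succ by (intro matched_path) (auto simp: L)
    have sp: "spider E y (A'' @ [r]) (rev A' @ [x]) [] r x y"
      using 4 d paths rpaths by (auto simp: spider_def L)
    show ?thesis by (rule close[OF sp _ eq m]) (auto simp: L)
  qed
qed

lemma three_points:
  assumes E: "symp E" and c: "cycle E L" "odd (length L)"
    and mem: "r \<in> set L" "x \<in> set L" "y \<in> set L"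
  shows "(\<exists>A A' A''. odd_triangle E r A x A' y A'' \<and> set (r # A @ x # A' @ y # A'') = set L) \<or>
    (\<exists>p L1 L2 L3. spider E p L1 L2 L3 r x y \<and> set (p # L1 @ L2 @ L3) \<subseteq> set L \<and>
       matched E (set L - set (p # L1 @ L2 @ L3)))" (is "?T \<or> ?S")
proof -
  consider (rx) "x = r" | (ry) "y = r" | (xy) "x = y" | (d) "x \<noteq> r" "y \<noteq> r" "x \<noteq> y" by blast
  then show ?thesis
  proof cases
    case rx
    obtain S where "successively E (r # S)" "distinct (r # S)" "even (length S)" "last (r # S) = y"
    "set (r # S) \<subseteq> set L" "matched E (set L - set (r # S))"
      using even_arc[OF E c mem(1,3)] .
    then show ?thesis using rx
      by (intro disjI2 exI[of _ r] exI[of _ "[]"] exI[of _ "[]"] exI[of _ S]) (auto simp: spider_def)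
  next
    case ry
    obtain S where "successively E (r # S)" "distinct (r # S)" "even (length S)" "last (r # S) = x"
    "set (r # S) \<subseteq> set L" "matched E (set L - set (r # S))"
      using even_arc[OF E c mem(1,2)] .
    then show ?thesis using ry
      by (intro disjI2 exI[of _ r] exI[of _ "[]"] exI[of _ S] exI[of _ "[]"]) (auto simp: spider_def)
  next
    case xy
    obtain S where "successively E (x # S)" "distinct (x # S)" "even (length S)" "last (x # S) = r"
    "set (x # S) \<subseteq> set L" "matched E (set L - set (x # S))"
      using even_arc[OF E c mem(2,1)] .
    then show ?thesis using xy
      by (intro disjI2 exI[of _ x] exI[of _ S] exI[of _ "[]"] exI[of _ "[]"]) (auto simp: spider_def)
  next
    case d
    obtain R where R: "cycle E (r # R)" "set (r # R) = set L" "length (r # R) = length L"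
      using cycle_start[OF c(1) mem(1)] .
    have "x \<in> set R" "y \<in> set R" using mem R d by auto
    then obtain A Z where AZ: "R = A @ x # Z" "y \<in> set A \<union> set Z"
      using d(3) split_list[of x R] by fastforce
    from AZ(2) consider "y \<in> set Z" | "y \<in> set A" by blast
    then show ?thesis
    proof cases
      case 1
      then obtain A' A'' where "Z = A' @ y # A''" using split_list by metis
      then have eq: "r # R = r # A @ x # A' @ y # A''" using AZ by simp
      have "odd (length (r # R))" using c(2) R(3) by simp
      from three_points_ordered[OF E R(1) this eq] show ?thesis
        unfolding R(2) using R(2) eq by metis
    next
      case 2
      then obtain A1 A2 where "A = A1 @ y # A2" using split_list by metis
      then have eq: "r # R = r # A1 @ y # A2 @ x # Z" using AZ by simp
      \<comment> \<open>Here \<open>y\<close> precedes \<open>x\<close>; traversing the cycle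
        backwards from \<open>r\<close> restores the order \<open>r\<close>, \<open>x\<close>,
        \<open>y\<close>.\<close>
      let ?L = "r # rev Z @ x # rev A2 @ y # rev A1"
      have "cycle E (rev (r # R))" using E R(1) by (rule cycle_rev)
      then have "cycle E ((rev Z @ x # rev A2 @ y # rev A1) @ [r])" unfolding eq by simp
      from cycle_rotate[OF this] have "cycle E ?L" by simp
      moreover have "length ?L = length L" using R(3) eq by simp
      then have "odd (length ?L)" using c(2) by simp
      moreover have "set ?L = set L" using R(2) eq by auto
      ultimately show ?thesis using three_points_ordered[OF E, of ?L, OF _ _ refl] by metis
    qed
  qed
qed

section \<open>Configurations\<close>

text \<open>The last three arguments are the current ends of the legs. Growing legs by two vertices
  at a time keeps their lengths even and allows rule induction on a configuration, from its core
  outwards, when it is lifted.\<close>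

inductive config ::
  "('v \<Rightarrow> 'v \<Rightarrow> bool) \<Rightarrow> 'v set \<Rightarrow> 'v \<Rightarrow> 'v \<Rightarrow> 'v \<Rightarrow> bool" for E where
  point: "config E {b} b b b"
| triangle: "odd_triangle E b1 A b2 A' b3 A'' \<Longrightarrow>
    config E (set (b1 # A @ b2 # A' @ b3 # A'')) b1 b2 b3"
| leg1: "config E X u1 u2 u3 \<Longrightarrow> x \<notin> X \<Longrightarrow> y \<notin> X \<Longrightarrow> x \<noteq> y \<Longrightarrow> E u1 x \<Longrightarrow> E x y \<Longrightarrow>
    config E (insert x (insert y X)) y u2 u3"
| leg2: "config E X u1 u2 u3 \<Longrightarrow> x \<notin> X \<Longrightarrow> y \<notin> X \<Longrightarrow> x \<noteq> y \<Longrightarrow> E u2 x \<Longrightarrow> E x y \<Longrightarrow>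
    config E (insert x (insert y X)) u1 y u3"
| leg3: "config E X u1 u2 u3 \<Longrightarrow> x \<notin> X \<Longrightarrow> y \<notin> X \<Longrightarrow> x \<noteq> y \<Longrightarrow> E u3 x \<Longrightarrow> E x y \<Longrightarrow>
    config E (insert x (insert y X)) u1 u2 y"

lemma config_ends: "config E X u1 u2 u3 \<Longrightarrow> u1 \<in> X \<and> u2 \<in> X \<and> u3 \<in> X"
  by (induction rule: config.induct) auto

lemma config_leg1_path:
  assumes "config E X u1 u2 u3" "successively E (u1 # L)" "distinct L" "even (length L)"
    "set L \<inter> X = {}"
  shows "config E (X \<union> set L) (last (u1 # L)) u2 u3"
  using assms
proof (induction L arbitrary: X u1 rule: induct_list012)
  case (3 x y L)
  then have "config E (insert x (insert y X)) y u2 u3" by (intro config.leg1) auto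
  from "3.IH"(1)[OF this] 3 show ?case by simp
qed auto

lemma config_leg2_path:
  assumes "config E X u1 u2 u3" "successively E (u2 # L)" "distinct L" "even (length L)"
    "set L \<inter> X = {}"
  shows "config E (X \<union> set L) u1 (last (u2 # L)) u3"
  using assms
proof (induction L arbitrary: X u2 rule: induct_list012)
  case (3 x y L)
  then have "config E (insert x (insert y X)) u1 y u3" by (intro config.leg2) auto
  from "3.IH"(1)[OF this] 3 show ?case by simp
qed auto

lemma config_leg3_path:
  assumes "config E X u1 u2 u3" "successively E (u3 # L)" "distinct L" "even (length L)"
    "set L \<inter> X = {}"
  shows "config E (X \<union> set L) u1 u2 (last (u3 # L))"
  using assms
proof (induction L arbitrary: X u3 rule: induct_list012)
  case (3 x y L)
  then have "config E (insert x (insert y X)) u1 u2 y" by (intro config.leg3) auto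
  from "3.IH"(1)[OF this] 3 show ?case by simp
qed auto

lemma cycle_mono:
  assumes "cycle E L" "\<And>x y. x \<in> set L \<Longrightarrow> y \<in> set L \<Longrightarrow> E x y \<Longrightarrow> E' x y"
  shows "cycle E' L"
  using assms by (auto simp: cycle_def intro: successively_mono)

lemma config_mono:
  assumes "config E X u1 u2 u3" "\<And>x y. x \<in> X \<Longrightarrow> y \<in> X \<Longrightarrow> E x y \<Longrightarrow> E' x y"
  shows "config E' X u1 u2 u3"
  using assms
proof (induction rule: config.induct)
  case (triangle b1 A b2 A' b3 A'')
  then have "odd_triangle E' b1 A b2 A' b3 A''"
    unfolding odd_triangle_def using cycle_mono by blast
  then show ?case by (rule config.triangle)
next
  case (leg1 X u1 u2 u3 x y)
  then show ?case using config_ends[OF leg1(1)] by (intro config.leg1) auto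
next
  case (leg2 X u1 u2 u3 x y)
  then show ?case using config_ends[OF leg2(1)] by (intro config.leg2) auto
next
  case (leg3 X u1 u2 u3 x y)
  then show ?case using config_ends[OF leg3(1)] by (intro config.leg3) auto
qed (auto intro: config.point)

lemma config_spider:
  assumes "spider E p L1 L2 L3 u1 u2 u3"
  shows "config E (set (p # L1 @ L2 @ L3)) u1 u2 u3"
proof -
  note s = assms[unfolded spider_def]
  have "config E ({p} \<union> set L1) (last (p # L1)) p p"
    by (rule config_leg1_path[OF config.point]) (use s in auto)
  then have "config E ({p} \<union> set L1 \<union> set L2) (last (p # L1)) (last (p # L2)) p"
    by (rule config_leg2_path) (use s in auto)
  then have "config E ({p} \<union> set L1 \<union> set L2 \<union> set L3)
      (last (p # L1)) (last (p # L2)) (last (p # L3))"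
    by (rule config_leg3_path) (use s in auto)
  then show ?thesis using s by (simp add: Un_assoc)
qed

section \<open>Contracting an odd cycle\<close>

text \<open>The contracted set \<open>B\<close> is represented by its element \<open>r\<close>.\<close>

definition contract :: "('v \<Rightarrow> 'v \<Rightarrow> bool) \<Rightarrow> 'v set \<Rightarrow> 'v \<Rightarrow> 'v \<Rightarrow> 'v \<Rightarrow> bool" where
  "contract E B r x y \<longleftrightarrow>
     x \<notin> B \<and> y \<notin> B \<and> E x y \<or>
     x = r \<and> y \<notin> B \<and> (\<exists>c\<in>B. E c y) \<or>
     y = r \<and> x \<notin> B \<and> (\<exists>c\<in>B. E x c)"

lemma symp_contract: "symp E \<Longrightarrow> symp (contract E B r)"
  unfolding symp_def contract_def by blast

text \<open>A leg that ends at \<open>r\<close> in the contracted graph may end at any vertex \<open>c2\<close> (or \<open>c3\<close>) of the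
  cycle after lifting.  This freedom carries the induction: the vertex at which the next two
  vertices of the leg are attached to the cycle depends on the edge by which it is extended.\<close>

lemma lift_config:
  assumes E: "symp E" and c: "cycle E C" "odd (length C)" and r: "r \<in> set C"
    and "config (contract E (set C) r) X u1 u2 u3"
    and "u1 = r" "X \<inter> set C \<subseteq> {r}" "c2 \<in> set C" "c3 \<in> set C"
  shows "\<exists>Y \<subseteq> X \<union> set C. matched E (X \<union> set C - Y) \<and>
    config E Y r (if u2 = r then c2 else u2) (if u3 = r then c3 else u3)"
  using assms(5-)
proof (induction arbitrary: c2 c3 rule: config.induct)
  case (point b)
  have C: "{b} \<union> set C = set C" using point r by auto
  \<comment> \<open>A configuration consisting of \<open>r\<close> alone is expanded to the cycle,
    with legs ending at \<open>r\<close>, \<open>c2\<close> and \<open>c3\<close>.\<close>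
  from three_points[OF E c r \<open>c2 \<in> set C\<close> \<open>c3 \<in> set C\<close>]
  consider (t) A A' A'' where "odd_triangle E r A c2 A' c3 A''"
      "set (r # A @ c2 # A' @ c3 # A'') = set C"
    | (s) p L1 L2 L3 where "spider E p L1 L2 L3 r c2 c3" "set (p # L1 @ L2 @ L3) \<subseteq> set C"
      "matched E (set C - set (p # L1 @ L2 @ L3))"
    by blast
  then show ?case
  proof cases
    case t
    then have "config E (set C) r c2 c3" using config.triangle by metis
    then show ?thesis using point C by (intro exI[of _ "set C"]) (auto intro: matched.empty)
  next
    case s
    have "config E (set (p # L1 @ L2 @ L3)) r c2 c3" using config_spider s(1) .
    then show ?thesis using point s C by (intro exI[of _ "set (p # L1 @ L2 @ L3)"]) auto
  qed
next
  case (triangle b1 A b2 A' b3 A'')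
  define L where "L = A @ b2 # A' @ b3 # A''"
  define X where "X = set (b1 # A @ b2 # A' @ b3 # A'')"
  have b1: "b1 = r" by fact
  have t: "cycle (contract E (set C) r) (r # L)" "even (length A)" "even (length A')" "even (length A'')"
    using triangle b1 by (auto simp: odd_triangle_def L_def)
  have X: "X = insert r (set L)" using b1 by (simp add: X_def L_def)
  have d: "r \<notin> set L" "distinct L" using t(1) by (auto simp: cycle_def)
  have LC: "set L \<inter> set C = {}" using triangle(3) d(1) unfolding X_def[symmetric] X by blast
  have "successively (contract E (set C) r) L"
    using t(1) by (auto simp: cycle_def successively_Cons)
  then have sL: "successively E L"
    by (rule successively_mono) (use LC d in \<open>auto simp: contract_def\<close>)
  have "L \<noteq> []" by (simp add: L_def)
  then have hl: "hd L \<in> set L" "last L \<in> set L" by auto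
  have "contract E (set C) r r (hd L)" "contract E (set C) r (last L) r"
    using t(1) \<open>L \<noteq> []\<close> by (auto simp: cycle_def successively_Cons)
  \<comment> \<open>The contracted triangle passes through \<open>r\<close> by two edges;
    \<open>d2\<close> and \<open>d3\<close> are the vertices of the cycle at which these edges
    really attach.\<close>
  then obtain d2 d3 where d2: "d2 \<in> set C" "E d2 (hd L)" and d3: "d3 \<in> set C" "E (last L) d3"
    using hl d LC r by (auto simp: contract_def)
  have hdL: "hd L = hd (A @ [b2])" "last L = last (b3 # A'')"
    by (auto simp: L_def hd_append)
  have ne: "b2 \<noteq> r" "b3 \<noteq> r" using d by (auto simp: L_def)
  from three_points[OF E c r d2(1) d3(1)]
  consider (t) D D' D'' where "odd_triangle E r D d2 D' d3 D''"
      "set (r # D @ d2 # D' @ d3 # D'') = set C"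
    | (s) p L1 L2 L3 where "spider E p L1 L2 L3 r d2 d3" "set (p # L1 @ L2 @ L3) \<subseteq> set C"
      "matched E (set C - set (p # L1 @ L2 @ L3))"
    by blast
  then have "\<exists>Y \<subseteq> X \<union> set C. matched E (X \<union> set C - Y) \<and> config E Y r b2 b3"
  proof cases
    case t': t
    \<comment> \<open>The triangle opens up: the arcs from \<open>r\<close> to \<open>d2\<close> and
      to \<open>d3\<close> continue along \<open>A\<close> and \<open>A''\<close>, giving even legs
      from \<open>r\<close> to \<open>b2\<close> and \<open>b3\<close>. The even paths
      \<open>D'\<close> and \<open>A'\<close> are left over and are matched separately.\<close>
    let ?L2 = "D @ d2 # A @ [b2]" and ?L3 = "rev (b3 # A'' @ d3 # D'')"
    have D: "cycle E (r # D @ d2 # D' @ d3 # D'')"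
      "even (length D)" "even (length D')" "even (length D'')"
      using t'(1) by (auto simp: odd_triangle_def)
    have sD: "successively E (r # D @ [d2])" "successively E (d3 # D'' @ [r])" "successively E D'"
      using D(1) by (auto simp: cycle_def successively_append_iff successively_Cons hd_append)
    have sA: "successively E (A @ [b2])" "successively E (b3 # A'')" "successively E A'"
      using sL by (auto simp: L_def successively_append_iff successively_Cons)
    have "successively E (r # ?L2)"
      using sD(1) sA(1) d2(2) hdL(1)
      by (auto simp: successively_append_iff successively_Cons hd_append)
    moreover have "successively E (rev (b3 # A'' @ d3 # D'' @ [r]))"
      unfolding successively_rev_symp[OF E]
      using sD(2) sA(2) d3(2) hdL(2)
      by (auto simp: successively_append_iff successively_Cons hd_append)
    then have "successively E (r # ?L3)" by simp
    moreover have disj: "distinct (r # D @ d2 # D' @ d3 # D'')" using D(1) by (simp add: cycle_def)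
    moreover have LC': "set L \<inter> set (r # D @ d2 # D' @ d3 # D'') = {}" using LC t'(2) by simp
    ultimately have "spider E r [] ?L2 ?L3 r b2 b3"
      using d t D by (auto simp: spider_def L_def)
    then have conf: "config E (set (r # [] @ ?L2 @ ?L3)) r b2 b3" by (rule config_spider)
    have "X \<union> set C - set (r # [] @ ?L2 @ ?L3) = set A' \<union> set D'"
      using LC' disj d unfolding X t'(2)[symmetric] by (auto simp: L_def)
    moreover have "matched E (set A' \<union> set D')"
    proof (rule matched_Un)
      show "matched E (set A')" using d t sA by (intro matched_path) (auto simp: L_def)
      show "matched E (set D')" using disj D sD by (intro matched_path) auto
      show "set A' \<inter> set D' = {}" using LC' by (auto simp: L_def)
    qed
    moreover have "set (r # [] @ ?L2 @ ?L3) \<subseteq> X \<union> set C"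
      unfolding X t'(2)[symmetric] by (auto simp: L_def)
    ultimately show ?thesis using conf by metis
  next
    case s
    let ?P = "set (p # L1 @ L2 @ L3)"
    \<comment> \<open>The center \<open>p\<close> takes over the role of \<open>b1\<close>: the legs
      to \<open>d2\<close> and \<open>d3\<close> lengthen two arcs of the triangle by even amounts,
      and \<open>L1\<close> becomes the first leg, from \<open>p\<close> to
      \<open>r\<close>.\<close>
    let ?T = "p # (L2 @ A) @ b2 # A' @ b3 # (A'' @ rev L3)"
    note sp = s(1)[unfolded spider_def]
    have p: "successively E (p # L2 @ L)"
      using sp sL d2(2) \<open>L \<noteq> []\<close> by (auto simp: successively_append_iff successively_Cons hd_append)
    have rL3: "rev (p # L3) = rev L3 @ [p]" by simp
    have q: "successively E (rev (p # L3))" "hd (rev (p # L3)) = d3"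
      using sp unfolding successively_rev_symp[OF E] by (auto simp: hd_rev)
    have q': "successively E ((p # L2 @ L) @ rev L3 @ [p])"
      using p q d3(2) \<open>L \<noteq> []\<close> unfolding rL3 successively_append_iff by simp
    have "successively E ?T \<and> E (last ?T) p"
    proof -
      have "(p # L2 @ L) @ rev L3 @ [p] = ?T @ [p]" by (simp add: L_def)
      then have "successively E (?T @ [p])" using q' by metis
      then show ?thesis unfolding successively_append_iff[of E ?T] by simp
    qed
    moreover have "distinct ?T" using sp d LC s(2) by (auto simp: L_def)
    ultimately have "odd_triangle E p (L2 @ A) b2 A' b3 (A'' @ rev L3)"
      using sp t by (auto simp: odd_triangle_def cycle_def)
    then have "config E (set ?T) p b2 b3" by (rule config.triangle)
    then have "config E (set ?T \<union> set L1) (last (p # L1)) b2 b3"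
      by (rule config_leg1_path) (use sp LC s(2) in \<open>auto simp: L_def\<close>)
    moreover have "set ?T \<union> set L1 = set L \<union> ?P" by (auto simp: L_def)
    ultimately have "config E (set L \<union> ?P) r b2 b3" using sp by simp
    moreover have "r \<in> ?P" using sp last_in_set[of "p # L1"] by auto
    then have "X \<union> set C - (set L \<union> ?P) = set C - ?P" unfolding X using LC by blast
    moreover have "set L \<union> ?P \<subseteq> X \<union> set C" unfolding X using s(2) by blast
    ultimately show ?thesis using s(3) by metis
  qed
  then show ?case using ne unfolding X_def by simp
next
  case (leg1 X u1 u2 u3 x y)
  note ends = config_ends[OF leg1(1)]
  have XC: "X \<inter> set C = {}" "x \<notin> set C" using leg1 r by auto
  have X: "config E X u1 u2 u3"
    by (rule config_mono[OF leg1(1)]) (use XC r in \<open>auto simp: contract_def\<close>)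
  have ux: "E u1 x" using leg1 XC ends r by (auto simp: contract_def)
  \<comment> \<open>The first leg enters the cycle only with its last vertex \<open>y\<close>, which
    is \<open>r\<close>. It is made to enter at \<open>d\<close> instead and to follow an even arc
    from \<open>d\<close> to \<open>r\<close>.\<close>
  obtain d where d: "d \<in> set C" "E x d" using leg1 XC r by (auto simp: contract_def)
  obtain S where S: "successively E (d # S)" "distinct (d # S)" "even (length S)"
    "last (d # S) = r" "set (d # S) \<subseteq> set C" "matched E (set C - set (d # S))"
    using even_arc[OF E c d(1) r] .
  have "config E (X \<union> set (x # d # S)) (last (u1 # x # d # S)) u2 u3"
    by (rule config_leg1_path[OF X]) (use S XC leg1 ux d in auto)
  moreover have "last (u1 # x # d # S) = r" using S by simp
  moreover have "insert x (insert y X) \<union> set C - (X \<union> set (x # d # S)) = set C - set (d # S)"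
    using XC S leg1 r by auto
  moreover have "u2 \<noteq> r" "u3 \<noteq> r" using ends XC r by auto
  ultimately show ?case using S(5,6)
    by (intro exI[of _ "X \<union> set (x # d # S)"]) auto
next
  case (leg2 X u1 u2 u3 x y)
  note ends = config_ends[OF leg2(1)]
  have xy: "x \<notin> set C" "y \<notin> set C" "x \<noteq> r" "y \<noteq> r" using leg2 ends by auto
  have "E x y" using leg2 xy r by (auto simp: contract_def)
  obtain d where d: "d \<in> set C" "E (if u2 = r then d else u2) x"
    using leg2 xy r by (auto simp: contract_def)
  \<comment> \<open>If the shorter leg ends at \<open>r\<close>, the induction hypothesis is asked
    for an end at \<open>d\<close>, where the edge to \<open>x\<close> attaches.\<close>
  obtain Y where Y: "Y \<subseteq> X \<union> set C" "matched E (X \<union> set C - Y)"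
    "config E Y r (if u2 = r then d else u2) (if u3 = r then c3 else u3)"
    using leg2.IH[of d c3] leg2.prems d(1) by auto
  have "config E (insert x (insert y Y)) r y (if u3 = r then c3 else u3)"
    by (rule config.leg2[OF Y(3)]) (use Y(1) leg2 xy d \<open>E x y\<close> in auto)
  moreover have "insert x (insert y X) \<union> set C - insert x (insert y Y) = X \<union> set C - Y"
    using leg2 xy by auto
  ultimately show ?case using Y xy by (intro exI[of _ "insert x (insert y Y)"]) auto
next
  case (leg3 X u1 u2 u3 x y)
  note ends = config_ends[OF leg3(1)]
  have xy: "x \<notin> set C" "y \<notin> set C" "x \<noteq> r" "y \<noteq> r" using leg3 ends by auto
  have "E x y" using leg3 xy r by (auto simp: contract_def)
  obtain d where d: "d \<in> set C" "E (if u3 = r then d else u3) x"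
    using leg3 xy r by (auto simp: contract_def)
  obtain Y where Y: "Y \<subseteq> X \<union> set C" "matched E (X \<union> set C - Y)"
    "config E Y r (if u2 = r then c2 else u2) (if u3 = r then d else u3)"
    using leg3.IH[of c2 d] leg3.prems d(1) by auto
  have "config E (insert x (insert y Y)) r (if u2 = r then c2 else u2) y"
    by (rule config.leg3[OF Y(3)]) (use Y(1) leg3 xy d \<open>E x y\<close> in auto)
  moreover have "insert x (insert y X) \<union> set C - insert x (insert y Y) = X \<union> set C - Y"
    using leg3 xy by auto
  ultimately show ?case using Y xy by (intro exI[of _ "insert x (insert y Y)"]) auto
qed

section \<open>Alternating paths\<close>

text \<open>An alternating path from an unmatched root \<open>r\<close> is given by the vertices at even positive
  distance from \<open>r\<close>; each of them is preceded by its mate.\<close>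

definition alt_path ::
  "('v \<Rightarrow> 'v \<Rightarrow> bool) \<Rightarrow> ('v \<Rightarrow> 'v) \<Rightarrow> 'v set \<Rightarrow> 'v \<Rightarrow> 'v list \<Rightarrow> bool" where
  "alt_path E m W r ys \<longleftrightarrow> successively (\<lambda>a b. E a (m b)) (r # ys) \<and> set ys \<subseteq> W \<and>
     distinct ys \<and> set ys \<inter> m ` set ys = {}"

text \<open>Inserts the mates before the vertices to recover the full path. The root is omitted, so
  the list has the form of a leg.\<close>

fun walk :: "('v \<Rightarrow> 'v) \<Rightarrow> 'v list \<Rightarrow> 'v list" where
  "walk m [] = []"
| "walk m (y # ys) = m y # y # walk m ys"

lemma walk_simps [simp]:
  "set (walk m ys) = set ys \<union> m ` set ys"
  "even (length (walk m ys))"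
  "walk m ys = [] \<longleftrightarrow> ys = []"
  "ys \<noteq> [] \<Longrightarrow> last (walk m ys) = last ys"
  "walk m (ys @ zs) = walk m ys @ walk m zs"
  by (induction ys) auto

lemma mate_image_iff:
  assumes "mate_on E m W" "S \<subseteq> W" "x \<in> W"
  shows "m x \<in> S \<longleftrightarrow> x \<in> m ` S" "m x \<in> m ` S \<longleftrightarrow> x \<in> S"
proof -
  have mm: "m (m y) = y" if "y \<in> W" for y using assms(1) that by (auto simp: mate_on_def)
  show "m x \<in> S \<longleftrightarrow> x \<in> m ` S" using mm assms(2,3) by (metis image_iff subsetD)
  show "m x \<in> m ` S \<longleftrightarrow> x \<in> S" using mm assms(2,3) by (metis image_iff subsetD)
qed

lemma walk_path:
  assumes "mate_on E m W" "symp E" "alt_path E m W r ys"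
  shows "successively E (r # walk m ys)" "distinct (walk m ys)"
proof -
  show "successively E (r # walk m ys)"
    using assms
  proof (induction ys arbitrary: r)
    case (Cons y ys)
    then have "successively E (y # walk m ys)" by (auto simp: alt_path_def)
    moreover have "E (m y) y" using Cons.prems by (auto simp: mate_on_def alt_path_def symp_def)
    ultimately show ?case using Cons.prems by (auto simp: alt_path_def)
  qed simp
  have "distinct ys" "set ys \<subseteq> W" "set ys \<inter> m ` set ys = {}"
    using assms(3) by (auto simp: alt_path_def)
  then show "distinct (walk m ys)"
  proof (induction ys)
    case (Cons y ys)
    moreover have "m y \<noteq> y" "m y \<notin> m ` set ys"
      using Cons.prems assms(1) by (auto simp: mate_on_def) (metis subsetD)+
    ultimately show ?case by auto
  qed simp
qed

lemma successively_split:
  "successively P (xs @ y # zs) \<longleftrightarrow> successively P (xs @ [y]) \<and> successively P (y # zs)"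
  by (auto simp: successively_append_iff)

lemma alt_path_suffix: "alt_path E m W r (A @ y # C) \<Longrightarrow> alt_path E m W y C"
  by (auto simp: alt_path_def successively_append_iff successively_Cons)

lemma alt_path_prefix:
  assumes "alt_path E m W r (A @ C)"
  shows "alt_path E m W r A"
proof -
  have "successively (\<lambda>a b. E a (m b)) ((r # A) @ C)" using assms by (simp add: alt_path_def)
  then show ?thesis using assms unfolding successively_append_iff[of _ "r # A"]
    by (auto simp: alt_path_def)
qed

text \<open>Only the first edge changes: it left the contracted set at \<open>c\<close> and now
  leaves from \<open>r\<close>. Since \<open>B\<close> is closed under mates within
  \<open>W\<close>, the other vertices on the path stay outside \<open>B\<close>.\<close>

lemma alt_path_contract:
  assumes "alt_path E m W c ys" "c \<in> B" "set ys \<inter> B = {}"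
    and "\<And>x. x \<in> W \<Longrightarrow> x \<in> B \<longleftrightarrow> m x \<in> B"
  shows "alt_path (contract E B r) m (W - B) r ys"
proof -
  have sub: "set ys \<subseteq> W - B" "m ` set ys \<inter> B = {}"
    using assms by (auto simp: alt_path_def)
  have "successively (\<lambda>a b. contract E B r a (m b)) ys"
    by (rule successively_mono[where P = "\<lambda>a b. E a (m b)"])
      (use assms(1) sub in \<open>auto simp: alt_path_def successively_Cons contract_def\<close>)
  moreover have "contract E B r r (m (hd ys))" if "ys \<noteq> []"
  proof -
    have "m (hd ys) \<notin> B" using sub hd_in_set[OF that] by blast
    moreover have "E c (m (hd ys))" using assms(1) that by (simp add: alt_path_def successively_Cons)
    ultimately show ?thesis using assms(2) by (auto simp: contract_def)
  qed
  ultimately show ?thesis using assms(1) sub by (auto simp: alt_path_def successively_Cons)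
qed

section \<open>Existence of configurations and of alternating paths\<close>

lemma cycleI:
  assumes "L \<noteq> []" "distinct L" "successively E (L @ [hd L])"
  shows "cycle E L"
  using assms by (simp add: cycle_def successively_append_iff)

text \<open>Induction on the number of matched vertices. The relation and the root vary as well,
  since the induction hypothesis is applied to a contracted graph or with a new root.\<close>

lemma config_exists:
  assumes "finite W" "r \<notin> W" "symp E" "mate_on E m W"
    "alt_path E m W r ys" "alt_path E m W r zs"
  shows "\<exists>X \<subseteq> insert r W. matched E (insert r W - X) \<and> config E X r (last (r # ys)) (last (r # zs))"
  using assms
proof (induction "card W" arbitrary: E W r ys zs rule: less_induct)
  case less
  note W = less.prems(1) and r = less.prems(2) and E = less.prems(3) and m = less.prems(4)
    and ys = less.prems(5) and zs = less.prems(6)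
  have mm: "m x \<in> W" "m x \<noteq> x" "m (m x) = x" "E x (m x)" if "x \<in> W" for x
    using m that by (auto simp: mate_on_def)
  note mS = mate_image_iff[OF m]
  \<comment> \<open>Both paths begin with \<open>r\<close>, \<open>m y\<close>, \<open>y\<close>.
    Deleting \<open>r\<close> and \<open>m y\<close> makes \<open>y\<close> the unmatched root;
    afterwards the two vertices extend the first leg from \<open>y\<close> through
    \<open>m y\<close> to \<open>r\<close>.\<close>
  have share: ?case
    if "alt_path E m W r (y # us)" "alt_path E m W r (y # vs)"
      "last (y # us) = last (r # ys)" "last (y # vs) = last (r # zs)" for y us vs
  proof -
    have y: "y \<in> W" "E r (m y)" using that(1) by (auto simp: alt_path_def)
    let ?W = "W - {y, m y}"
    have "mate_on E m ?W"
    proof (rule mate_on_Diff[OF m])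
      show "x \<in> {y, m y} \<longleftrightarrow> m x \<in> {y, m y}" if "x \<in> W" for x
        using mm that y by (metis insert_iff singletonD)
    qed
    moreover have "alt_path E m ?W y us" "alt_path E m ?W y vs"
      using that(1,2) by (auto simp: alt_path_def)
    moreover have "card ?W < card W" using W y by (intro psubset_card_mono) auto
    ultimately obtain X where X: "X \<subseteq> insert y ?W" "matched E (insert y ?W - X)"
      "config E X y (last (y # us)) (last (y # vs))"
      using less.hyps[of ?W y E us vs] W E by auto
    have "config E (insert (m y) (insert r X)) r (last (y # us)) (last (y # vs))"
      by (rule config.leg1[OF X(3)]) (use X(1) r y mm[of y] sympD[OF E] in auto)
    moreover have "insert r W - insert (m y) (insert r X) = insert y ?W - X"
      using X(1) r y mm[of y] by auto
    ultimately show ?thesis using X mm[of y] y that(3,4)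
      by (intro exI[of _ "insert (m y) (insert r X)"]) auto
  qed
  have ysW: "set ys \<subseteq> W" "distinct ys" "set ys \<inter> m ` set ys = {}"
    and zsW: "set zs \<subseteq> W" "distinct zs" "set zs \<inter> m ` set zs = {}"
    using ys zs by (auto simp: alt_path_def)
  \<comment> \<open>The vertex set of the path of \<open>ys\<close> without its root is closed under
    mates, so a vertex off it has its mate off it. Thus only the vertices listed in
    \<open>zs\<close> need to be tested for meeting that path.\<close>
  have avoid: "m ` S \<inter> (set ys \<union> m ` set ys) = {}"
    if "S \<subseteq> W" "S \<inter> (set ys \<union> m ` set ys) = {}" for S
  proof -
    have "m z \<notin> set ys \<union> m ` set ys" if z: "z \<in> S" for z
    proof -
      have "z \<in> W" "z \<notin> set ys \<union> m ` set ys" using z \<open>S \<subseteq> W\<close> \<open>S \<inter> (set ys \<union> m ` set ys) = {}\<close> by blast+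
      then show ?thesis using mS[OF ysW(1) \<open>z \<in> W\<close>] by simp
    qed
    then show ?thesis by blast
  qed
  show ?case
  proof (cases "\<exists>z\<in>set zs. z \<in> set ys \<union> m ` set ys")
    case False
    let ?X = "set (r # [] @ walk m ys @ walk m zs)"
    have disj: "(set ys \<union> m ` set ys) \<inter> (set zs \<union> m ` set zs) = {}"
      using False avoid[OF zsW(1)] by blast
    have "r \<notin> m ` set ys" "r \<notin> m ` set zs" using r mm ysW zsW by auto
    then have "spider E r [] (walk m ys) (walk m zs) r (last (r # ys)) (last (r # zs))"
      using walk_path[OF m E ys] walk_path[OF m E zs] r ysW zsW disj by (auto simp: spider_def)
    then have "config E ?X r (last (r # ys)) (last (r # zs))" by (rule config_spider)
    moreover have "?X \<subseteq> insert r W" using mm ysW zsW by auto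
    moreover have "matched E (insert r W - ?X)"
    proof -
      have "mate_on E m (W - ?X)"
      proof (rule mate_on_Diff[OF m])
        show "x \<in> ?X \<longleftrightarrow> m x \<in> ?X" if "x \<in> W" for x
          using mm(1)[OF that] that r mS[OF ysW(1) that] mS[OF zsW(1) that] by auto
      qed
      moreover have "insert r W - ?X = W - ?X" by auto
      ultimately show ?thesis using W by (simp add: mate_on_matched)
    qed
    ultimately show ?thesis by blast
  next
    case True
    \<comment> \<open>The full path of \<open>zs\<close> visits \<open>m z\<close> just before
      \<open>z\<close>, so \<open>m z\<close> is its first vertex after \<open>r\<close> on the path
      of \<open>ys\<close>. Hence \<open>z\<close> in \<open>ys\<close> means that they first meet
      at odd distance along \<open>ys\<close>; otherwise they first meet at even distance.\<close>
    then obtain D z F where zs_eq: "zs = D @ z # F" and z: "z \<in> set ys \<union> m ` set ys"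
      and D: "\<forall>d\<in>set D. d \<notin> set ys \<union> m ` set ys"
      using split_list_first_prop[of zs "\<lambda>z. z \<in> set ys \<union> m ` set ys"] by blast
    have DW: "set D \<subseteq> W" using zsW by (simp add: zs_eq)
    have D': "set D \<inter> (set ys \<union> m ` set ys) = {}" "m ` set D \<inter> (set ys \<union> m ` set ys) = {}"
      using D avoid[OF DW] by blast+
    from z show ?thesis
    proof
      assume "z \<in> set ys"
      then obtain A C where ys_eq: "ys = A @ z # C" using split_list by metis
      \<comment> \<open>Following \<open>zs\<close> up to \<open>z\<close> and then
        \<open>ys\<close> is a new alternating path to the end of \<open>ys\<close>. It begins with
        the same entry as \<open>zs\<close>, so \<open>share\<close> applies.\<close>
      have "alt_path E m W r (D @ z # C)"
        unfolding alt_path_def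
      proof (intro conjI)
        have "successively (\<lambda>a b. E a (m b)) ((r # D) @ [z])"
          using zs unfolding alt_path_def zs_eq append_Cons[symmetric]
          by (subst (asm) successively_split) blast
        moreover have "successively (\<lambda>a b. E a (m b)) (z # C)"
          using ys unfolding alt_path_def ys_eq append_Cons[symmetric]
          by (subst (asm) successively_split) blast
        ultimately have "successively (\<lambda>a b. E a (m b)) ((r # D) @ z # C)"
          by (subst successively_split) blast
        then show "successively (\<lambda>a b. E a (m b)) (r # D @ z # C)" by simp
        show "set (D @ z # C) \<subseteq> W" using ysW(1) DW by (simp add: ys_eq)
        show "distinct (D @ z # C)" using ysW(2) zsW(2) D'(1) by (auto simp: ys_eq zs_eq)
        have "set (z # C) \<subseteq> set ys" by (auto simp: ys_eq)
        moreover have "set D \<inter> m ` set D = {}" using zsW(3) unfolding zs_eq by auto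
        moreover have "set (z # C) \<inter> m ` set (z # C) = {}" "set D \<inter> m ` set (z # C) = {}"
          "m ` set D \<inter> set (z # C) = {}"
          using calculation(1) image_mono[OF calculation(1), of m] ysW(3) D' by blast+
        ultimately show "set (D @ z # C) \<inter> m ` set (D @ z # C) = {}"
          unfolding set_append image_Un Int_Un_distrib Int_Un_distrib2 by (simp add: Int_commute)
      qed
      with zs show ?thesis
        using share[of z C F] share[of "hd D" "tl D @ z # C" "tl D @ z # F"]
        by (cases D) (simp_all add: ys_eq zs_eq)
    next
      assume "z \<in> m ` set ys"
      then obtain y where y: "y \<in> set ys" "z = m y" by blast
      then obtain A C where ys_eq: "ys = A @ y # C" using split_list by metis
      \<comment> \<open>The blossom: out to \<open>y\<close> along \<open>ys\<close> and back along
        \<open>zs\<close>. The edge joining the two parts is the one by which \<open>zs\<close>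
        reaches \<open>m z = y\<close>.\<close>
      let ?L = "r # walk m (A @ [y]) @ rev (walk m D)"
      define B where "B = set ?L"
      have B: "B = insert r (set A \<union> m ` set A \<union> {y, m y} \<union> set D \<union> m ` set D)"
        by (auto simp: B_def)
      have yW: "y \<in> W" "m (m y) = y" using y(1) ysW(1) mm(3) by blast+
      have altA: "alt_path E m W r (A @ [y])" and altD: "alt_path E m W r D"
        using ys zs alt_path_prefix[of E m W r "A @ [y]" C] alt_path_prefix[of E m W r D]
        by (auto simp: ys_eq zs_eq)
      have "cycle E ?L"
      proof (rule cycleI)
        have "r \<notin> m ` set ys" "r \<notin> m ` set D" using r mm ysW zsW by (auto simp: zs_eq)
        then have "r \<notin> set (walk m ys)" "r \<notin> set (walk m D)" using r ysW(1) DW by auto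
        moreover have "set (walk m (A @ [y])) \<subseteq> set (walk m ys)"
          by (auto simp: ys_eq)
        moreover have "set (walk m D) \<inter> set (walk m ys) = {}"
          using D' by (simp add: Int_Un_distrib2)
        ultimately show "distinct ?L"
          using walk_path(2)[OF m E altA] walk_path(2)[OF m E altD]
          by (simp only: distinct.simps distinct_append distinct_rev set_append set_rev) blast
        have "successively E (rev (r # walk m D))"
          unfolding successively_rev_symp[OF E] using walk_path[OF m E altD] by blast
        moreover have "hd (rev (r # walk m D)) = last (r # D)"
          by (simp add: hd_rev del: rev.simps)
        moreover have "E (last (r # D)) y"
          using zs yW unfolding alt_path_def zs_eq y(2)
          by (auto simp: successively_append_iff successively_Cons)
        then have "E y (last (r # D))" using E by (rule sympD[rotated])
        moreover have "last (r # walk m (A @ [y])) = y" by simp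
        ultimately have "successively E ((r # walk m (A @ [y])) @ rev (r # walk m D))"
          using walk_path[OF m E altA] unfolding successively_append_iff by metis
        then show "successively E (?L @ [hd ?L])" by simp
      qed simp
      have odd: "odd (length ?L)" using walk_simps(2)[of m "A @ [y]"] walk_simps(2)[of m D] by simp
      have BW: "B \<subseteq> insert r W" "r \<in> B" "y \<in> B" "m y \<in> B"
        using ysW zsW mm by (auto simp: B ys_eq zs_eq)
      have Bm: "x \<in> B \<longleftrightarrow> m x \<in> B" if "x \<in> W" for x
      proof -
        have "B = insert r (S \<union> m ` S)" if "S = set A \<union> {y} \<union> set D" for S
          unfolding B that by auto
        moreover have "set A \<union> {y} \<union> set D \<subseteq> W" using ysW DW by (auto simp: ys_eq)
        ultimately show ?thesis using mS[OF _ that, of "set A \<union> {y} \<union> set D"] mm(1)[OF that] that r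
          by (metis Un_iff insert_iff)
      qed
      have "set C \<inter> B = {}"
        using ysW D' r by (auto simp: B ys_eq)
      have altC: "alt_path E m W y C" using ys unfolding ys_eq by (rule alt_path_suffix)
      \<comment> \<open>The path of \<open>zs\<close> may return to the blossom, so it is cut at its
        last entry \<open>w\<close> in \<open>B\<close>. After contraction both tails,
        \<open>C\<close> from \<open>y\<close> and \<open>H\<close> from \<open>w\<close>, start at
        \<open>r\<close>.\<close>
      obtain G w H where zs_eq': "zs = G @ w # H" and w: "w \<in> B" and H: "\<forall>h\<in>set H. h \<notin> B"
        using split_list_last_prop[of zs "\<lambda>h. h \<in> B"] BW(4) by (auto simp: zs_eq y(2))
      have altH: "alt_path E m W w H" using zs unfolding zs_eq' by (rule alt_path_suffix)
      let ?E = "contract E B r" and ?W = "W - B"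
      have aC: "alt_path ?E m ?W r C"
        by (rule alt_path_contract[OF altC BW(3) \<open>set C \<inter> B = {}\<close> Bm])
      have aH: "alt_path ?E m ?W r H"
        by (rule alt_path_contract[OF altH w _ Bm]) (use H in auto)
      have "mate_on E m ?W" by (rule mate_on_Diff[OF m Bm])
      then have "mate_on ?E m ?W" by (auto simp: mate_on_def contract_def)
      moreover have "card ?W < card W" using W yW BW by (intro psubset_card_mono) auto
      ultimately obtain X where X: "X \<subseteq> insert r ?W" "matched ?E (insert r ?W - X)"
        "config ?E X r (last (r # C)) (last (r # H))"
        using less.hyps[of ?W r ?E C H] W r symp_contract[OF E] aC aH by auto
      have rX: "r \<in> X" using config_ends[OF X(3)] by blast
      have m1: "matched E (insert r ?W - X)"
        by (rule matched_mono[OF X(2)]) (use rX in \<open>auto simp: contract_def\<close>)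
      \<comment> \<open>If \<open>C\<close> or \<open>H\<close> is empty, the corresponding leg ends
        at \<open>r\<close> in the contracted graph; the lift moves this end to \<open>y\<close> or
        \<open>w\<close>, which is then the end of \<open>ys\<close> or \<open>zs\<close>.\<close>
      obtain Y where Y: "Y \<subseteq> X \<union> B" "matched E (X \<union> B - Y)"
        "config E Y r (if last (r # C) = r then y else last (r # C))
          (if last (r # H) = r then w else last (r # H))"
        using lift_config[OF E \<open>cycle E ?L\<close> odd, folded B_def, OF BW(2) X(3) refl _ BW(3) w] X(1)
        by blast
      have "last C \<in> W" if "C \<noteq> []" using last_in_set[OF that] ysW by (auto simp: ys_eq)
      then have e1: "(if last (r # C) = r then y else last (r # C)) = last (r # ys)"
        using r by (auto simp: ys_eq)
      have "last H \<in> W" if "H \<noteq> []" using last_in_set[OF that] zsW by (auto simp: zs_eq')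
      then have e2: "(if last (r # H) = r then w else last (r # H)) = last (r # zs)"
        using r by (auto simp: zs_eq')
      have split: "insert r W - Y = (insert r ?W - X) \<union> (X \<union> B - Y)"
        using X(1) Y(1) BW rX by auto
      have "matched E ((insert r ?W - X) \<union> (X \<union> B - Y))"
        using m1 Y(2) by (rule matched_Un) (use rX in auto)
      then have "matched E (insert r W - Y)" unfolding split .
      moreover have "Y \<subseteq> insert r W" using X(1) Y(1) BW by auto
      ultimately show ?thesis using Y(3) unfolding e1 e2 by blast
    qed
  qed
qed

text \<open>The path is a component of the symmetric difference of the two matchings:
  \<open>m'\<close> leads from the root to \<open>x\<close>, and \<open>m\<close> from
  \<open>x\<close> to the next root. It can only stop at \<open>s\<close>, the vertex that
  \<open>m'\<close> misses.\<close>

lemma alt_path_exists: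
  assumes "finite W" "r \<notin> W" "s \<in> insert r W" "mate_on E m W" "mate_on E m' (insert r W - {s})"
  shows "\<exists>ys. alt_path E m W r ys \<and> last (r # ys) = s"
  using assms
proof (induction "card W" arbitrary: W r rule: less_induct)
  case less
  note m = less.prems(4) and m' = less.prems(5)
  show ?case
  proof (cases "r = s")
    case True
    then show ?thesis by (intro exI[of _ "[]"]) (simp add: alt_path_def)
  next
    case False
    define x where "x = m' r"
    have x: "x \<in> W" "x \<noteq> s" "E r x" "m' x = r"
      using m' False unfolding mate_on_def x_def by (metis DiffE DiffI insert_iff singletonD)+
    define y where "y = m x"
    have y: "y \<in> W" "y \<noteq> x" "m y = x" using m x(1) by (auto simp: mate_on_def y_def)
    let ?W = "W - {y, x}"
    have "mate_on E m ?W"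
    proof (rule mate_on_Diff[OF m])
      show "z \<in> {y, x} \<longleftrightarrow> m z \<in> {y, x}" if "z \<in> W" for z
        using m that x y unfolding mate_on_def by (metis insert_iff singletonD)
    qed
    moreover have "mate_on E m' (insert y ?W - {s})"
    proof -
      have "mate_on E m' (insert r W - {s} - {r, x})"
      proof (rule mate_on_Diff[OF m'])
        show "z \<in> {r, x} \<longleftrightarrow> m' z \<in> {r, x}" if "z \<in> insert r W - {s}" for z
          using m' that x x_def unfolding mate_on_def by (metis insert_iff singletonD)
      qed
      moreover have "insert r W - {s} - {r, x} = insert y ?W - {s}"
        using less.prems(2) y by auto
      ultimately show ?thesis by simp
    qed
    moreover have "card ?W < card W" using less.prems(1) y by (intro psubset_card_mono) auto
    moreover have "s \<in> insert y ?W" using less.prems(3) False x(2) by auto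
    ultimately obtain ys where ys: "alt_path E m ?W y ys" "last (y # ys) = s"
      using less.hyps[of ?W y] less.prems(1) by auto
    have "y \<notin> m ` set ys"
    proof
      assume "y \<in> m ` set ys"
      then obtain z where "z \<in> ?W" "y = m z" using ys(1) by (auto simp: alt_path_def)
      then show False using m y unfolding mate_on_def by (metis DiffE insert_iff)
    qed
    then have "alt_path E m W r (y # ys)"
      using ys(1) x y by (auto simp: alt_path_def)
    then show ?thesis using ys(2) by (intro exI[of _ "y # ys"]) simp
  qed
qed

section \<open>Bi-subdivisions from configurations\<close>

definition leg :: "('v \<Rightarrow> 'v \<Rightarrow> bool) \<Rightarrow> 'v \<Rightarrow> 'v list \<Rightarrow> 'v \<Rightarrow> bool" where
  "leg E b L u \<longleftrightarrow> successively E (b # L) \<and> even (length L) \<and> last (b # L) = u"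

lemma leg_extend: "leg E b L u \<Longrightarrow> E u x \<Longrightarrow> E x y \<Longrightarrow> leg E b (L @ [x, y]) y"
  unfolding leg_def using successively_append_iff[of E "b # L" "[x, y]"] by simp

lemma spider_legs:
  "spider E p L1 L2 L3 u1 u2 u3 \<longleftrightarrow>
     leg E p L1 u1 \<and> leg E p L2 u2 \<and> leg E p L3 u3 \<and> distinct (p # L1 @ L2 @ L3)"
  by (auto simp: spider_def leg_def)

definition legged_triangle where
  "legged_triangle E b1 A b2 A' b3 A'' L1 L2 L3 u1 u2 u3 \<longleftrightarrow>
     odd_triangle E b1 A b2 A' b3 A'' \<and> leg E b1 L1 u1 \<and> leg E b2 L2 u2 \<and> leg E b3 L3 u3 \<and>
     distinct (b1 # A @ b2 # A' @ b3 # A'' @ L1 @ L2 @ L3)"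

text \<open>Each leg rule appends two vertices to one leg and keeps the core. The explicit lists are
  needed to name the paths of a subdivision.\<close>

lemma config_cases:
  assumes "config E X u1 u2 u3"
  shows "(\<exists>p L1 L2 L3. spider E p L1 L2 L3 u1 u2 u3 \<and> X = set (p # L1 @ L2 @ L3)) \<or>
    (\<exists>b1 A b2 A' b3 A'' L1 L2 L3. legged_triangle E b1 A b2 A' b3 A'' L1 L2 L3 u1 u2 u3 \<and>
       X = set (b1 # A @ b2 # A' @ b3 # A'' @ L1 @ L2 @ L3))" (is "?S X u1 u2 u3 \<or> ?T X u1 u2 u3")
  using assms
proof (induction rule: config.induct)
  case (point b)
  have "spider E b [] [] [] b b b" by (simp add: spider_def)
  then show ?case by (intro disjI1 exI[of _ b] exI[of _ "[]"]) simp
next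
  case (triangle b1 A b2 A' b3 A'')
  then have "legged_triangle E b1 A b2 A' b3 A'' [] [] [] b1 b2 b3"
    by (auto simp: legged_triangle_def leg_def odd_triangle_def cycle_def)
  then have "?T (set (b1 # A @ b2 # A' @ b3 # A'' @ [] @ [] @ [])) b1 b2 b3" by blast
  then show ?case by simp
next
  case (leg1 X u1 u2 u3 x y)
  from leg1.IH show ?case
  proof (elim disjE exE conjE)
    fix p L1 L2 L3
    assume "spider E p L1 L2 L3 u1 u2 u3" "X = set (p # L1 @ L2 @ L3)"
    then have "spider E p (L1 @ [x, y]) L2 L3 y u2 u3 \<and>
      insert x (insert y X) = set (p # (L1 @ [x, y]) @ L2 @ L3)"
      using leg1 leg_extend[of E p L1 u1 x y] by (auto simp: spider_legs)
    then show ?thesis by blast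
  next
    fix b1 A b2 A' b3 A'' L1 L2 L3
    assume "legged_triangle E b1 A b2 A' b3 A'' L1 L2 L3 u1 u2 u3"
      "X = set (b1 # A @ b2 # A' @ b3 # A'' @ L1 @ L2 @ L3)"
    then have "legged_triangle E b1 A b2 A' b3 A'' (L1 @ [x, y]) L2 L3 y u2 u3 \<and>
      insert x (insert y X) = set (b1 # A @ b2 # A' @ b3 # A'' @ (L1 @ [x, y]) @ L2 @ L3)"
      using leg1 leg_extend[of E b1 L1 u1 x y] by (auto simp: legged_triangle_def)
    then show ?thesis by blast
  qed
next
  case (leg2 X u1 u2 u3 x y)
  from leg2.IH show ?case
  proof (elim disjE exE conjE)
    fix p L1 L2 L3
    assume "spider E p L1 L2 L3 u1 u2 u3" "X = set (p # L1 @ L2 @ L3)"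
    then have "spider E p L1 (L2 @ [x, y]) L3 u1 y u3 \<and>
      insert x (insert y X) = set (p # L1 @ (L2 @ [x, y]) @ L3)"
      using leg2 leg_extend[of E p L2 u2 x y] by (auto simp: spider_legs)
    then show ?thesis by blast
  next
    fix b1 A b2 A' b3 A'' L1 L2 L3
    assume "legged_triangle E b1 A b2 A' b3 A'' L1 L2 L3 u1 u2 u3"
      "X = set (b1 # A @ b2 # A' @ b3 # A'' @ L1 @ L2 @ L3)"
    then have "legged_triangle E b1 A b2 A' b3 A'' L1 (L2 @ [x, y]) L3 u1 y u3 \<and>
      insert x (insert y X) = set (b1 # A @ b2 # A' @ b3 # A'' @ L1 @ (L2 @ [x, y]) @ L3)"
      using leg2 leg_extend[of E b2 L2 u2 x y] by (auto simp: legged_triangle_def)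
    then show ?thesis by blast
  qed
next
  case (leg3 X u1 u2 u3 x y)
  from leg3.IH show ?case
  proof (elim disjE exE conjE)
    fix p L1 L2 L3
    assume "spider E p L1 L2 L3 u1 u2 u3" "X = set (p # L1 @ L2 @ L3)"
    then have "spider E p L1 L2 (L3 @ [x, y]) u1 u2 y \<and>
      insert x (insert y X) = set (p # L1 @ L2 @ (L3 @ [x, y]))"
      using leg3 leg_extend[of E p L3 u3 x y] by (auto simp: spider_legs)
    then show ?thesis by blast
  next
    fix b1 A b2 A' b3 A'' L1 L2 L3
    assume "legged_triangle E b1 A b2 A' b3 A'' L1 L2 L3 u1 u2 u3"
      "X = set (b1 # A @ b2 # A' @ b3 # A'' @ L1 @ L2 @ L3)"
    then have "legged_triangle E b1 A b2 A' b3 A'' L1 L2 (L3 @ [x, y]) u1 u2 y \<and>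
      insert x (insert y X) = set (b1 # A @ b2 # A' @ b3 # A'' @ L1 @ L2 @ (L3 @ [x, y]))"
      using leg3 leg_extend[of E b3 L3 u3 x y] by (auto simp: legged_triangle_def)
    then show ?thesis by blast
  qed
qed

section \<open>From adjacency to paths with explicit edges\<close>

definition adj :: "('v, 'e) mgraph \<Rightarrow> 'v \<Rightarrow> 'v \<Rightarrow> bool" where
  "adj G x y \<longleftrightarrow> (\<exists>e\<in>edges G. ends G e = {x, y})"

lemma symp_adj: "symp (adj G)"
  by (auto simp: symp_def adj_def insert_commute)

lemma is_path_Cons:
  assumes "is_path G vs es" "x \<in> verts G" "x \<notin> set vs" "e \<in> edges G" "ends G e = {x, hd vs}"
  shows "is_path G (x # vs) (e # es)"
  using assms by (cases vs) (auto simp: is_path_def nth_Cons split: nat.splits)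

lemma is_path_snoc:
  assumes "is_path G vs es" "x \<in> verts G" "x \<notin> set vs" "e \<in> edges G" "ends G e = {last vs, x}"
  shows "is_path G (vs @ [x]) (es @ [e])"
proof -
  have "last vs = vs ! length es" using assms(1) by (subst last_conv_nth) (auto simp: is_path_def)
  then show ?thesis using assms by (auto simp: is_path_def nth_append less_Suc_eq)
qed

lemma path_exists:
  assumes "successively (adj G) vs" "distinct vs" "vs \<noteq> []" "set vs \<subseteq> verts G"
  shows "\<exists>es. is_path G vs es"
  using assms
proof (induction vs)
  case (Cons x vs)
  show ?case
  proof (cases "vs = []")
    case True
    then show ?thesis using Cons.prems by (intro exI[of _ "[]"]) (auto simp: is_path_def)
  next
    case False
    then obtain es where "is_path G vs es" using Cons by (auto simp: successively_Cons)
    moreover obtain e where "e \<in> edges G" "ends G e = {x, hd vs}"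
      using Cons.prems False by (auto simp: successively_Cons adj_def)
    ultimately show ?thesis using Cons.prems is_path_Cons[of G vs es x e] by auto
  qed
qed simp

lemma is_path_ends: "is_path G vs es \<Longrightarrow> set vs = {hd vs, last vs} \<union> set (inner_verts vs)"
proof -
  assume "is_path G vs es"
  then have "vs \<noteq> []" by (auto simp: is_path_def)
  then show ?thesis
    by (cases vs; cases "tl vs" rule: rev_cases) (auto simp: inner_verts_def)
qed

text \<open>Only a path of length one has an edge that avoids all inner vertices; this turns
  disjointness of inner vertices into disjointness of edges.\<close>

lemma is_path_edge:
  assumes "is_path G vs es" "e \<in> set es"
  shows "ends G e \<subseteq> set vs"
    and "ends G e \<inter> set (inner_verts vs) \<noteq> {} \<or> es = [e] \<and> ends G e = {hd vs, last vs}"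
proof -
  obtain i where i: "i < length es" "es ! i = e" using assms(2) by (auto simp: in_set_conv_nth)
  have len: "length vs = Suc (length es)" and e: "ends G e = {vs ! i, vs ! Suc i}"
    using assms(1) i by (auto simp: is_path_def)
  show "ends G e \<subseteq> set vs" using i len e by auto
  have inner: "vs ! j \<in> set (inner_verts vs)" if "0 < j" "j < length es" for j
  proof -
    have "inner_verts vs ! (j - 1) = vs ! j" "j - 1 < length (inner_verts vs)"
      using that len by (auto simp: inner_verts_def nth_butlast nth_tl)
    then show ?thesis by (metis nth_mem)
  qed
  consider "0 < i" | "Suc i < length es" | "i = 0" "length es = 1" using i by linarith
  then show "ends G e \<inter> set (inner_verts vs) \<noteq> {} \<or> es = [e] \<and> ends G e = {hd vs, last vs}"
  proof cases
    case 1
    then show ?thesis using inner[of i] i e by auto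
  next
    case 2
    then show ?thesis using inner[of "Suc i"] e by auto
  next
    case 3
    then have "es = [e]" using i by (cases es) auto
    moreover have "vs \<noteq> []" using len by auto
    then have "hd vs = vs ! 0" "last vs = vs ! Suc 0"
      using 3 len by (simp_all add: hd_conv_nth last_conv_nth)
    ultimately show ?thesis using 3 e by simp
  qed
qed

lemma bi_subdivisionI:
  assumes J: "graph J" and G: "graph G" and inj: "inj_on \<phi> (verts J)" and \<phi>: "\<phi> ` verts J \<subseteq> verts G"
    and path: "\<And>e. e \<in> edges J \<Longrightarrow> is_path G (Pv e) (Pe e)"
    and ends: "\<And>e. e \<in> edges J \<Longrightarrow> {hd (Pv e), last (Pv e)} = \<phi> ` ends J e"
    and even: "\<And>e. e \<in> edges J \<Longrightarrow> even (length (inner_verts (Pv e)))"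
    and inner: "\<And>e. e \<in> edges J \<Longrightarrow> set (inner_verts (Pv e)) \<inter> \<phi> ` verts J = {}"
    and disj: "\<And>e f. e \<in> edges J \<Longrightarrow> f \<in> edges J \<Longrightarrow> e \<noteq> f \<Longrightarrow>
      set (inner_verts (Pv e)) \<inter> set (inner_verts (Pv f)) = {}"
    and parallel: "\<And>e f. e \<in> edges J \<Longrightarrow> f \<in> edges J \<Longrightarrow> e \<noteq> f \<Longrightarrow> ends J e = ends J f \<Longrightarrow> Pe e \<noteq> Pe f"
    and H: "H = \<lparr>verts = \<phi> ` verts J \<union> (\<Union>e\<in>edges J. set (inner_verts (Pv e))),
      edges = (\<Union>e\<in>edges J. set (Pe e)), ends = ends G\<rparr>"
  shows "bi_subdivision J H \<and> subgraph H G"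
proof -
  have Jends: "ends J e \<subseteq> verts J" if "e \<in> edges J" for e using J that by (auto simp: graph_def)
  have Pv: "set (Pv e) = \<phi> ` ends J e \<union> set (inner_verts (Pv e))" if "e \<in> edges J" for e
    using is_path_ends[OF path[OF that]] ends[OF that] by simp
  have PvH: "set (Pv e) \<subseteq> verts H" if "e \<in> edges J" for e
    using Pv[OF that] Jends[OF that] that by (auto simp: H)
  have PvG: "set (Pv e) \<subseteq> verts G" "set (Pe e) \<subseteq> edges G" if "e \<in> edges J" for e
    using path[OF that] by (auto simp: is_path_def)
  have "set (inner_verts (Pv e)) \<subseteq> verts G" if "e \<in> edges J" for e
    using PvG(1)[OF that] unfolding Pv[OF that] by blast
  then have HG: "verts H \<subseteq> verts G" "edges H \<subseteq> edges G"
    unfolding H using \<phi> PvG(2) by (simp_all add: UN_subset_iff)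
  have gH: "graph H"
    unfolding graph_def
  proof (intro conjI ballI)
    show "finite (verts H)" "finite (edges H)"
      using HG G by (auto simp: graph_def intro: finite_subset)
    fix x assume x: "x \<in> edges H"
    then obtain e where e: "e \<in> edges J" "x \<in> set (Pe e)" by (auto simp: H)
    show "ends H x \<subseteq> verts H"
      using is_path_edge(1)[OF path[OF e(1)] e(2)] PvH[OF e(1)] by (auto simp: H)
    show "card (ends H x) = 2" using x HG G by (auto simp: graph_def H)
  qed
  have sub: "subgraph H G" unfolding subgraph_def using gH G HG by (auto simp: H)
  \<comment> \<open>A common edge of two paths meets no inner vertex of either, so each path is this
    single edge. By injectivity of \<phi> the two edges of \<open>J\<close> are then parallel, which
    \<open>parallel\<close> excludes.\<close>
  have edisj: "set (Pe e) \<inter> set (Pe f) = {}" if ef: "e \<in> edges J" "f \<in> edges J" "e \<noteq> f" for e f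
  proof (rule ccontr)
    assume "set (Pe e) \<inter> set (Pe f) \<noteq> {}"
    then obtain x where x: "x \<in> set (Pe e)" "x \<in> set (Pe f)" by blast
    have no: "ends G x \<inter> set (inner_verts (Pv g)) = {}"
      if "g \<in> edges J" "h \<in> edges J" "g \<noteq> h" "x \<in> set (Pe h)" for g h
      using is_path_edge(1)[OF path[OF that(2)] that(4)] Pv[OF that(2)] Jends[OF that(2)]
        inner[OF that(1)] disj[OF that(1-3)] by blast
    have "Pe e = [x]" "ends G x = \<phi> ` ends J e"
      using is_path_edge(2)[OF path[OF ef(1)] x(1)] no[OF ef x(2)] ends[OF ef(1)] by auto
    moreover have "Pe f = [x]" "ends G x = \<phi> ` ends J f"
      using is_path_edge(2)[OF path[OF ef(2)] x(2)] no[OF ef(2,1) _ x(1)] ends[OF ef(2)] ef(3) by auto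
    ultimately show False
      using parallel[OF ef] inj_on_image_eq_iff[OF inj Jends[OF ef(1)] Jends[OF ef(2)]] by auto
  qed
  have pathH: "is_path H (Pv e) (Pe e)" if "e \<in> edges J" for e
    using path[OF that] PvH[OF that] that unfolding is_path_def by (auto simp: H)
  have "bi_subdivision J H"
    unfolding bi_subdivision_def
    using J gH inj pathH ends even inner disj edisj
    by (intro conjI exI[of _ \<phi>] exI[of _ Pv] exI[of _ Pe]) (auto simp: H)
  with sub show ?thesis by blast
qed

section \<open>From vertex matchings to perfect matchings\<close>

lemma matched_edges:
  assumes "matched (adj G) X"
  shows "\<exists>M. matching G M \<and> (\<forall>e\<in>M. ends G e \<subseteq> X) \<and> (\<forall>v\<in>X. \<exists>e\<in>M. v \<in> ends G e)"
  using assms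
proof (induction rule: matched.induct)
  case empty
  show ?case by (intro exI[of _ "{}"]) (auto simp: matching_def)
next
  case (pair X x y)
  then obtain M where M: "matching G M" "\<forall>e\<in>M. ends G e \<subseteq> X" "\<forall>v\<in>X. \<exists>e\<in>M. v \<in> ends G e"
    by blast
  obtain e where e: "e \<in> edges G" "ends G e = {x, y}" using pair by (auto simp: adj_def)
  have "ends G e \<inter> ends G f = {}" if "f \<in> M" for f
  proof -
    have "ends G f \<subseteq> X" using M(2) that by blast
    then show ?thesis unfolding e(2) using pair(2,3) by auto
  qed
  then have "ends G f \<inter> ends G g = {}" if "f \<in> insert e M" "g \<in> insert e M" "f \<noteq> g" for f g
    using that M(1) unfolding matching_def by (metis Int_commute insertE)
  then have "matching G (insert e M)" using M(1) e(1) by (simp add: matching_def)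
  moreover have "\<forall>f\<in>insert e M. ends G f \<subseteq> insert x (insert y X)" using M(2) e(2) by blast
  moreover have "\<forall>v\<in>insert x (insert y X). \<exists>f\<in>insert e M. v \<in> ends G f" using M(3) e(2) by blast
  ultimately show ?case by blast
qed

lemma matchable_delete_verts:
  assumes "matched (adj G) (verts G - S)"
  shows "matchable (delete_verts G S)"
proof -
  obtain M where M: "matching G M" "\<forall>e\<in>M. ends G e \<subseteq> verts G - S"
    "\<forall>v\<in>verts G - S. \<exists>e\<in>M. v \<in> ends G e"
    using matched_edges[OF assms] by blast
  then have "perfect_matching (delete_verts G S) M"
    by (auto simp: perfect_matching_def matching_def delete_verts_def)
  then show ?thesis by (auto simp: matchable_def)
qed

text \<open>The second property ties the mates to the edges of \<open>M\<close>: choosing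
  \<open>M\<close> to contain a claw edge makes the ends of that edge mates.\<close>

lemma perfect_matching_mate:
  assumes G: "graph G" and M: "perfect_matching G M"
  obtains m where "mate_on (adj G) m (verts G)"
    "\<And>e x y. e \<in> M \<Longrightarrow> ends G e = {x, y} \<Longrightarrow> m x = y"
proof -
  define m where "m x = (SOME y. \<exists>e\<in>M. ends G e = {x, y})" for x
  have uniq: "y = z" if "e \<in> M" "f \<in> M" "ends G e = {x, y}" "ends G f = {x, z}" for e f x y z
  proof -
    have "x \<in> ends G e \<inter> ends G f" using that by simp
    then have "e = f" using M that(1,2) unfolding perfect_matching_def matching_def by blast
    then show ?thesis using that by (auto simp: doubleton_eq_iff)
  qed
  have m: "m x = y" if "e \<in> M" "ends G e = {x, y}" for e x y
    unfolding m_def by (rule some_equality) (use that uniq in blast)+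
  have "m x \<in> verts G \<and> m x \<noteq> x \<and> m (m x) = x \<and> adj G x (m x)" if x: "x \<in> verts G" for x
  proof -
    obtain e where e: "e \<in> M" "x \<in> ends G e" using M x by (auto simp: perfect_matching_def)
    have eG: "e \<in> edges G" using M e(1) by (auto simp: perfect_matching_def matching_def)
    then have 2: "card (ends G e) = 2" "ends G e \<subseteq> verts G" using G by (auto simp: graph_def)
    then obtain y where y: "ends G e = {x, y}" "y \<noteq> x"
      using e(2) by (auto simp: card_2_iff doubleton_eq_iff)
    have "m x = y" "m y = x" using m[OF e(1)] y(1) by (auto simp: insert_commute)
    then show ?thesis using y 2 eG by (auto simp: adj_def)
  qed
  then show ?thesis using that[of m] m by (auto simp: mate_on_def)
qed

lemma mate_on_remove_edge:
  assumes "mate_on E m V" "v \<in> V" "m v = u"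
  shows "mate_on E m (V - {v, u})"
  using assms(1)
proof (rule mate_on_Diff)
  show "x \<in> {v, u} \<longleftrightarrow> m x \<in> {v, u}" if "x \<in> V" for x
    using assms that unfolding mate_on_def by (metis insert_iff singletonD)
qed

section \<open>The claw\<close>

lemma inner_verts_snoc: "inner_verts (p # L @ [v]) = L"
  by (simp add: inner_verts_def)

text \<open>The last edge is prescribed, whereas \<open>adj\<close> would only provide some edge
  with the same ends; this is how the claw edges themselves get into the subdivision.\<close>

lemma leg_path:
  assumes "leg (adj G) b L u" "distinct (b # L)" "set (b # L) \<subseteq> verts G" "v \<in> verts G"
    "v \<notin> set (b # L)" "e \<in> edges G" "ends G e = {v, u}"
  shows "\<exists>es. is_path G (b # L @ [v]) (es @ [e])"
proof -
  obtain es where es: "is_path G (b # L) es"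
    using path_exists[of G "b # L"] assms by (auto simp: leg_def)
  have "ends G e = {last (b # L), v}" using assms by (auto simp: leg_def)
  from is_path_snoc[OF es assms(4,5,6) this] show ?thesis by auto
qed

section \<open>Adding the center of the claw to a spider\<close>

lemma Theta_graph: "graph Theta"
  by (simp add: graph_def Theta_def)

lemma Theta_bi_subdivision:
  assumes G: "graph G" and v: "v \<in> verts G" "v \<notin> X"
    and sp: "spider (adj G) p L1 L2 L3 u1 u2 u3" and X: "X = set (p # L1 @ L2 @ L3)" "X \<subseteq> verts G"
    and e: "e1 \<in> edges G" "e2 \<in> edges G" "e3 \<in> edges G" "distinct [e1, e2, e3]"
      "ends G e1 = {v, u1}" "ends G e2 = {v, u2}" "ends G e3 = {v, u3}"
  shows "\<exists>H. bi_subdivision Theta H \<and> subgraph H G \<and> verts H = insert v X \<and> {e1, e2, e3} \<subseteq> edges H"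
proof -
  note s = sp[unfolded spider_legs]
  obtain es1 where es1: "is_path G (p # L1 @ [v]) (es1 @ [e1])"
    using leg_path[of G p L1 u1 v e1] s X v e by auto
  obtain es2 where es2: "is_path G (p # L2 @ [v]) (es2 @ [e2])"
    using leg_path[of G p L2 u2 v e2] s X v e by auto
  obtain es3 where es3: "is_path G (p # L3 @ [v]) (es3 @ [e3])"
    using leg_path[of G p L3 u3 v e3] s X v e by auto
  define \<phi> where "\<phi> i = (if i = 0 then v else p)" for i :: nat
  define Pv where "Pv i = (if i = 0 then p # L1 @ [v] else if i = 1 then p # L2 @ [v] else p # L3 @ [v])"
    for i :: nat
  define Pe where "Pe i = (if i = 0 then es1 @ [e1] else if i = 1 then es2 @ [e2] else es3 @ [e3])"
    for i :: nat
  define H where "H = \<lparr>verts = \<phi> ` verts Theta \<union> (\<Union>e\<in>edges Theta. set (inner_verts (Pv e))),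
      edges = (\<Union>e\<in>edges Theta. set (Pe e)), ends = ends G\<rparr>"
  note defs = Theta_def \<phi>_def Pv_def Pe_def
  have "bi_subdivision Theta H \<and> subgraph H G"
  proof (rule bi_subdivisionI[OF Theta_graph G _ _ _ _ _ _ _ _ H_def])
    show "inj_on \<phi> (verts Theta)" using v X by (auto simp: defs)
    show "\<phi> ` verts Theta \<subseteq> verts G" using v X by (auto simp: defs)
    fix i assume i: "i \<in> edges Theta"
    show "is_path G (Pv i) (Pe i)" using es1 es2 es3 by (simp add: defs)
    show "{hd (Pv i), last (Pv i)} = \<phi> ` ends Theta i" by (auto simp: defs)
    show "even (length (inner_verts (Pv i)))" using s by (simp add: defs inner_verts_snoc leg_def)
    show "set (inner_verts (Pv i)) \<inter> \<phi> ` verts Theta = {}"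
      using s v X by (auto simp: defs inner_verts_snoc)
    fix j assume j: "j \<in> edges Theta" "i \<noteq> j"
    show "set (inner_verts (Pv i)) \<inter> set (inner_verts (Pv j)) = {}"
      using s i j by (auto simp: defs inner_verts_snoc)
    \<comment> \<open>Two legs may both be empty, with parallel claw edges as their paths; the paths
      still differ because they end in distinct claw edges.\<close>
    show "Pe i \<noteq> Pe j" using e(4) i j by (auto simp: defs)
  qed
  moreover have "verts H = insert v X" by (auto simp: H_def defs inner_verts_snoc X)
  moreover have "{e1, e2, e3} \<subseteq> edges H" by (auto simp: H_def defs)
  ultimately show ?thesis by blast
qed

section \<open>Adding the center of the claw to a legged triangle\<close>

lemma K4_edges: "edges K4 = {{0, 1}, {0, 2}, {0, 3}, {1, 2}, {2, 3}, {1, 3}}"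
proof -
  have four: "e \<in> {{0, 1}, {0, 2}, {0, 3}, {1, 2}, {2, 3}, {1, 3}}" if e: "e \<subseteq> {0..<4}" "card e = 2"
    for e :: "nat set"
  proof -
    obtain x y where "e = {x, y}" "x \<noteq> y" using e(2) by (auto simp: card_2_iff)
    then obtain a b where ab: "e = {a, b}" "a < b" by (metis insert_commute linorder_neqE_nat)
    then have "b < 4" using e(1) by simp
    then have "b = 0 \<or> b = 1 \<or> b = 2 \<or> b = 3" by linarith
    moreover from \<open>b < 4\<close> ab(2) have "a = 0 \<or> a = 1 \<or> a = 2" by linarith
    ultimately show ?thesis unfolding ab(1) using ab(2) by (elim disjE) simp_all
  qed
  have "edges K4 \<subseteq> {{0, 1}, {0, 2}, {0, 3}, {1, 2}, {2, 3}, {1, 3}}"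
  proof
    fix e assume "e \<in> edges K4"
    then have "e \<subseteq> {0..<4}" "card e = 2" by (simp_all add: K4_def)
    then show "e \<in> {{0, 1}, {0, 2}, {0, 3}, {1, 2}, {2, 3}, {1, 3}}" by (rule four)
  qed
  moreover have "{{0, 1}, {0, 2}, {0, 3}, {1, 2}, {2, 3}, {1, 3}} \<subseteq> edges K4"
    unfolding K4_def by (simp add: card_insert_if)
  ultimately show ?thesis by (rule equalityI)
qed

lemma K4_graph: "graph K4"
proof -
  have "edges K4 \<subseteq> Pow {0..<4}" by (auto simp: K4_def)
  then have "finite (edges K4)" by (rule finite_subset) simp
  then show ?thesis by (auto simp: graph_def K4_def)
qed

lemma arc_path:
  assumes "successively (adj G) (b # A @ [c])" "distinct (b # A @ [c])" "set (b # A @ [c]) \<subseteq> verts G"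
  shows "\<exists>es. is_path G (b # A @ [c]) es"
  using path_exists[OF assms(1,2) _ assms(3)] by blast

lemma K4_bi_subdivision:
  assumes G: "graph G" and v: "v \<in> verts G" "v \<notin> X"
    and tr: "legged_triangle (adj G) b1 A b2 A' b3 A'' L1 L2 L3 u1 u2 u3"
    and X: "X = set (b1 # A @ b2 # A' @ b3 # A'' @ L1 @ L2 @ L3)" "X \<subseteq> verts G"
    and e: "e1 \<in> edges G" "e2 \<in> edges G" "e3 \<in> edges G"
      "ends G e1 = {v, u1}" "ends G e2 = {v, u2}" "ends G e3 = {v, u3}"
  shows "\<exists>H. bi_subdivision K4 H \<and> subgraph H G \<and> verts H = insert v X \<and> {e1, e2, e3} \<subseteq> edges H"
proof -
  note t = tr[unfolded legged_triangle_def odd_triangle_def cycle_def]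
  have d: "distinct (b1 # A @ b2 # A' @ b3 # A'' @ L1 @ L2 @ L3)" using t by blast
  have ev: "even (length A)" "even (length A')" "even (length A'')"
    "even (length L1)" "even (length L2)" "even (length L3)"
    using t by (auto simp: leg_def)
  have "leg (adj G) b1 L1 u1" "leg (adj G) b2 L2 u2" "leg (adj G) b3 L3 u3" using t by auto
  then obtain es1 es2 es3 where es: "is_path G (b1 # L1 @ [v]) (es1 @ [e1])"
    "is_path G (b2 # L2 @ [v]) (es2 @ [e2])" "is_path G (b3 # L3 @ [v]) (es3 @ [e3])"
    using leg_path[of G b1 L1 u1 v e1] leg_path[of G b2 L2 u2 v e2] leg_path[of G b3 L3 u3 v e3]
      d X v e by auto
  have "successively (adj G) (b1 # A @ b2 # A' @ b3 # A'')"
    "adj G (last (b1 # A @ b2 # A' @ b3 # A'')) b1" using t by simp_all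
  then have "successively (adj G) (b1 # A @ [b2])" "successively (adj G) (b2 # A' @ [b3])"
    "successively (adj G) (b3 # A'' @ [b1])"
    by (auto simp: successively_append_iff successively_Cons hd_append)
  then obtain fs1 fs2 fs3 where fs: "is_path G (b1 # A @ [b2]) fs1" "is_path G (b2 # A' @ [b3]) fs2"
    "is_path G (b3 # A'' @ [b1]) fs3"
    using arc_path[of G b1 A b2] arc_path[of G b2 A' b3] arc_path[of G b3 A'' b1] d X by auto
  \<comment> \<open>Vertex 0 of \<open>K4\<close> is the center of the claw. Its edges become the
    legs completed by claw edges, and the edges among 1, 2, 3 become the arcs of the cycle.\<close>
  define \<phi> where "\<phi> i = (if i = 0 then v else if i = 1 then b1 else if i = 2 then b2 else b3)"
    for i :: nat
  define Pv where "Pv e = (if e = {0, 1} then b1 # L1 @ [v] else if e = {0, 2} then b2 # L2 @ [v]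
    else if e = {0, 3} then b3 # L3 @ [v] else if e = {1, 2} then b1 # A @ [b2]
    else if e = {2, 3} then b2 # A' @ [b3] else b3 # A'' @ [b1])" for e :: "nat set"
  define Pe where "Pe e = (if e = {0, 1} then es1 @ [e1] else if e = {0, 2} then es2 @ [e2]
    else if e = {0, 3} then es3 @ [e3] else if e = {1, 2} then fs1
    else if e = {2, 3} then fs2 else fs3)" for e :: "nat set"
  define H where "H = \<lparr>verts = \<phi> ` verts K4 \<union> (\<Union>e\<in>edges K4. set (inner_verts (Pv e))),
      edges = (\<Union>e\<in>edges K4. set (Pe e)), ends = ends G\<rparr>"
  have Pv: "Pv {0, 1} = b1 # L1 @ [v]" "Pv {0, 2} = b2 # L2 @ [v]" "Pv {0, 3} = b3 # L3 @ [v]"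
    "Pv {1, 2} = b1 # A @ [b2]" "Pv {2, 3} = b2 # A' @ [b3]" "Pv {1, 3} = b3 # A'' @ [b1]"
    by (simp_all add: Pv_def doubleton_eq_iff)
  have Pe: "Pe {0, 1} = es1 @ [e1]" "Pe {0, 2} = es2 @ [e2]" "Pe {0, 3} = es3 @ [e3]"
    "Pe {1, 2} = fs1" "Pe {2, 3} = fs2" "Pe {1, 3} = fs3"
    by (simp_all add: Pe_def doubleton_eq_iff)
  have \<phi>: "\<phi> 0 = v" "\<phi> 1 = b1" "\<phi> 2 = b2" "\<phi> 3 = b3" by (simp_all add: \<phi>_def)
  have K4v: "verts K4 = {0, 1, 2, 3}" by (auto simp: K4_def)
  have \<phi>K: "\<phi> ` verts K4 = {v, b1, b2, b3}" unfolding K4v by (auto simp: \<phi>_def)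
  have vn: "v \<notin> set (b1 # A @ b2 # A' @ b3 # A'' @ L1 @ L2 @ L3)" using v X by simp
  define I where "I e = inner_verts (Pv e)" for e
  have I: "I {0, 1} = L1" "I {0, 2} = L2" "I {0, 3} = L3" "I {1, 2} = A" "I {2, 3} = A'" "I {1, 3} = A''"
    by (simp_all only: I_def Pv inner_verts_snoc)
  have "bi_subdivision K4 H \<and> subgraph H G"
  proof (rule bi_subdivisionI[OF K4_graph G _ _ _ _ _ _ _ _ H_def])
    show "inj_on \<phi> (verts K4)" unfolding K4v using d vn by (auto simp: \<phi>_def)
    show "\<phi> ` verts K4 \<subseteq> verts G" unfolding \<phi>K using v X by auto
    fix i assume i: "i \<in> edges K4"
    show "is_path G (Pv i) (Pe i)" using i es fs unfolding K4_edges by (auto simp only: Pv Pe)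
    show "{hd (Pv i), last (Pv i)} = \<phi> ` ends K4 i"
    proof -
      have "ends K4 i = i" by (simp add: K4_def)
      then show ?thesis using i unfolding K4_edges
        by (elim insertE emptyE) (simp_all only: Pv image_insert image_empty \<phi>, auto)
    qed
    show "even (length (inner_verts (Pv i)))"
      using i ev unfolding K4_edges I_def[symmetric] by (elim insertE emptyE) (simp_all only: I)
    show "set (inner_verts (Pv i)) \<inter> \<phi> ` verts K4 = {}"
      using i d vn unfolding K4_edges I_def[symmetric] \<phi>K
      by (elim insertE emptyE) (simp_all only: I, auto)
    fix j assume j: "j \<in> edges K4" "i \<noteq> j"
    show "set (inner_verts (Pv i)) \<inter> set (inner_verts (Pv j)) = {}"
    proof -
      have ds: "set L1 \<inter> set L2 = {}" "set L1 \<inter> set L3 = {}" "set L2 \<inter> set L3 = {}"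
        "set A \<inter> set A' = {}" "set A \<inter> set A'' = {}" "set A' \<inter> set A'' = {}"
        "set A \<inter> set L1 = {}" "set A \<inter> set L2 = {}" "set A \<inter> set L3 = {}"
        "set A' \<inter> set L1 = {}" "set A' \<inter> set L2 = {}" "set A' \<inter> set L3 = {}"
        "set A'' \<inter> set L1 = {}" "set A'' \<inter> set L2 = {}" "set A'' \<inter> set L3 = {}"
        using d by (simp_all add: Int_Un_distrib Int_commute)
      note ds' = ds[THEN trans[OF Int_commute]]
      show ?thesis
        using i j unfolding K4_edges I_def[symmetric]
        by (elim insertE emptyE) (simp_all only: I ds ds' not_True_eq_False refl)
    qed
    show "Pe i \<noteq> Pe j" if "ends K4 i = ends K4 j" using that j by (simp add: K4_def)
  qed
  moreover have "verts H = {v, b1, b2, b3} \<union> (\<Union>e\<in>edges K4. set (I e))"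
    unfolding H_def \<phi>K I_def by simp
  then have "verts H = insert v X"
    unfolding K4_edges X UN_insert UN_empty I by auto
  moreover have "edges H = (\<Union>e\<in>edges K4. set (Pe e))" by (simp add: H_def)
  then have "{e1, e2, e3} \<subseteq> edges H"
    unfolding K4_edges UN_insert UN_empty Pe by auto
  ultimately show ?thesis by blast
qed

theorem theorem2p7:
  fixes G K :: "('v, 'e) mgraph"
  assumes "matching_covered G"
    and "three_claw G K"
  shows "\<exists>H. subgraph K H \<and> conformal G H \<and> (bi_subdivision Theta H \<or> bi_subdivision K4 H)"
proof -
  have G: "graph G" and cov: "\<And>e. e \<in> edges G \<Longrightarrow> \<exists>M. perfect_matching G M \<and> e \<in> M"
    using assms(1) by (auto simp: matching_covered_def)
  have K: "subgraph K G" "card (edges K) = 3" "verts K = (\<Union>e\<in>edges K. ends K e)"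
    using assms(2) by (auto simp: three_claw_def)
  obtain v where v: "\<And>e. e \<in> edges K \<Longrightarrow> v \<in> ends K e"
    using assms(2) by (auto simp: three_claw_def)
  obtain e1 e2 e3 where e: "edges K = {e1, e2, e3}" "distinct [e1, e2, e3]"
    using K(2) by (auto simp: card_3_iff)
  \<comment> \<open>A perfect matching containing the claw edge from \<open>v\<close> to
    \<open>u\<close> leaves, without that edge, a perfect matching of the graph minus
    \<open>v\<close> and \<open>u\<close>.\<close>
  have star: "\<exists>u m. u \<in> verts G \<and> u \<noteq> v \<and> v \<in> verts G \<and> e \<in> edges G \<and> ends G e = {v, u} \<and>
      mate_on (adj G) m (verts G - {v, u})" if eK: "e \<in> edges K" for e
  proof -
    have eG: "e \<in> edges G" "v \<in> ends G e" using K(1) eK v[OF eK] by (auto simp: subgraph_def)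
    then have "card (ends G e) = 2" and sub: "ends G e \<subseteq> verts G" using G by (auto simp: graph_def)
    then obtain u where u: "ends G e = {v, u}" "u \<noteq> v" using eG(2) by (auto simp: card_2_iff doubleton_eq_iff)
    obtain M where M: "perfect_matching G M" "e \<in> M" using cov[OF eG(1)] by blast
    obtain m where m: "mate_on (adj G) m (verts G)"
      "\<And>e x y. e \<in> M \<Longrightarrow> ends G e = {x, y} \<Longrightarrow> m x = y"
      using perfect_matching_mate[OF G M(1)] by metis
    have "mate_on (adj G) m (verts G - {v, u})"
      using m(1) _ m(2)[OF M(2) u(1)] by (rule mate_on_remove_edge) (use sub u in auto)
    then show ?thesis using u sub eG(1) by blast
  qed
  obtain u1 m1 where u1: "u1 \<in> verts G" "u1 \<noteq> v" "v \<in> verts G" "e1 \<in> edges G" "ends G e1 = {v, u1}"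
    "mate_on (adj G) m1 (verts G - {v, u1})" using star[of e1] e by blast
  obtain u2 m2 where u2: "u2 \<in> verts G" "u2 \<noteq> v" "e2 \<in> edges G" "ends G e2 = {v, u2}"
    "mate_on (adj G) m2 (verts G - {v, u2})" using star[of e2] e by blast
  obtain u3 m3 where u3: "u3 \<in> verts G" "u3 \<noteq> v" "e3 \<in> edges G" "ends G e3 = {v, u3}"
    "mate_on (adj G) m3 (verts G - {v, u3})" using star[of e3] e by blast
  \<comment> \<open>In the graph minus \<open>v\<close>, the matching \<open>m1\<close> misses only
    \<open>u1\<close>, while \<open>m2\<close> and \<open>m3\<close> miss only \<open>u2\<close> and
    \<open>u3\<close>. Comparing \<open>m1\<close> with each of them yields the two alternating
    paths from \<open>u1\<close>.\<close>
  define W where "W = verts G - {v, u1}"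
  have W: "finite W" "u1 \<notin> W" "insert u1 W = verts G - {v}"
    using G u1 by (auto simp: W_def graph_def)
  have W': "insert u1 W - {u} = verts G - {v, u}" for u unfolding W(3) by auto
  have m1: "mate_on (adj G) m1 W" using u1(6) by (simp add: W_def)
  obtain ys where ys: "alt_path (adj G) m1 W u1 ys" "last (u1 # ys) = u2"
    using alt_path_exists[OF W(1,2) _ m1, of u2 m2] u2 W' W(3) by auto
  obtain zs where zs: "alt_path (adj G) m1 W u1 zs" "last (u1 # zs) = u3"
    using alt_path_exists[OF W(1,2) _ m1, of u3 m3] u3 W' W(3) by auto
  obtain X where X: "X \<subseteq> verts G - {v}" "matched (adj G) (verts G - {v} - X)"
    "config (adj G) X u1 u2 u3"
    using config_exists[OF W(1,2) symp_adj m1 ys(1) zs(1)] ys(2) zs(2) W(3) by auto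
  have vX: "v \<notin> X" "X \<subseteq> verts G" using X(1) by auto
  obtain H where H: "bi_subdivision Theta H \<or> bi_subdivision K4 H" "subgraph H G"
    "verts H = insert v X" "{e1, e2, e3} \<subseteq> edges H"
    using config_cases[OF X(3)]
  proof (elim disjE exE conjE)
    fix p L1 L2 L3
    assume "spider (adj G) p L1 L2 L3 u1 u2 u3" "X = set (p # L1 @ L2 @ L3)"
    from Theta_bi_subdivision[OF G u1(3) vX(1) this vX(2) u1(4) u2(3) u3(3) e(2) u1(5) u2(4) u3(4)]
    show ?thesis using that by blast
  next
    fix b1 A b2 A' b3 A'' L1 L2 L3
    assume "legged_triangle (adj G) b1 A b2 A' b3 A'' L1 L2 L3 u1 u2 u3"
      "X = set (b1 # A @ b2 # A' @ b3 # A'' @ L1 @ L2 @ L3)"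
    from K4_bi_subdivision[OF G u1(3) vX(1) this vX(2) u1(4) u2(3) u3(3) u1(5) u2(4) u3(4)]
    show ?thesis using that by blast
  qed
  have "verts G - verts H = verts G - {v} - X" using H(3) by auto
  then have "matchable (delete_verts G (verts H))" using X(2) by (simp add: matchable_delete_verts)
  then have "conformal G H" using H(2) by (simp add: conformal_def)
  moreover have "subgraph K H"
  proof -
    have "edges K \<subseteq> edges H" using H(4) e(1) by simp
    moreover have "ends K x = ends H x" "ends K x \<subseteq> verts H" if "x \<in> edges K" for x
    proof -
      have "x \<in> edges H" using that calculation by blast
      then have "ends H x = ends G x" "ends H x \<subseteq> verts H"
        using H(2) unfolding subgraph_def graph_def by blast+
      moreover have "ends K x = ends G x" using K(1) that by (simp add: subgraph_def)
      ultimately show "ends K x = ends H x" "ends K x \<subseteq> verts H" by auto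
    qed
    moreover have "verts K \<subseteq> verts H" unfolding K(3) using calculation(3) by blast
    ultimately show ?thesis using K(1) H(2) by (simp add: subgraph_def)
  qed
  ultimately show ?thesis using H(1) by blast
qed

end
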